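(* For each $n$ let $\mu_n$ be a conjugacy-invariant probability distribution on $\mathfrak{S}_n$ and let $\Sigma_n\sim\mu_n$, and let $\alpha\in[0,1]$ be such that $\mathbb{P}\big(\lim_{n\to\infty}m_1(\Sigma_n)/n=\alpha\big)=1$. Let $\mu_\alpha=(1-\alpha)U+\alpha D$, where $U$ is Lebesgue measure on $[0,1]\times[0,1]$ and $D$ is the uniform (Lebesgue) measure on the diagonal $\{(x,x):x\in[0,1]\}$ (the pushforward of Lebesgue measure on $[0,1]$ under $x\mapsto(x,x)$). Then $\mu_n\to\mu_\alpha$, i.e. for every $k\ge1$ and every $v\in\mathfrak{S}_k$, $$\frac{N_v(\Sigma_n)}{\binom{n}{k}}\to\mathbb{P}\big(\Pi^{\mu_\alpha}_k=v\big)\quad\text{(in probability) as } n\to\infty.$$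
   Context: A probability distribution $\mu_n$ on $\mathfrak{S}_n$ is conjugacy-invariant if $\mu_n(w^{-1}\pi w)=\mu_n(\pi)$ for all $\pi,w$. $m_1(\pi)$ is the number of fixed points of $\pi$. For $v\in\mathfrak{S}_k$, $N_v(\pi)$ is the number of index sets $i_1<\dots<i_k$ in $[n]$ with $\pi(i_1),\dots,\pi(i_k)$ in the same relative order as $v(1),\dots,v(k)$. A permuton is a Borel probability measure $\mu$ on $[0,1]^2$ whose two marginals are both Lebesgue measure on $[0,1]$. For a permuton $\mu$, $\Pi^\mu_k$ is the random permutation obtained by sampling $(X_1,Y_1),\dots,(X_k,Y_k)$ i.i.d. from $\mu$, relabeling so that $X_1<\dots<X_k$, and taking the permutation in $\mathfrak{S}_k$ with the same relative order as $(Y_1,\dots,Y_k)$. *)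

theory Defs
  imports "HOL-Probability.Probability" "HOL-Combinatorics.Permutations"
begin

text \<open>Permutations of [n] are represented 0-based as functions nat => nat that
  permute {..<n} (and fix everything else).\<close>

definition fixed_points :: "nat \<Rightarrow> (nat \<Rightarrow> nat) \<Rightarrow> nat" where
  "fixed_points n \<pi> = card {i \<in> {..<n}. \<pi> i = i}"

definition pattern_count :: "nat \<Rightarrow> (nat \<Rightarrow> nat) \<Rightarrow> nat \<Rightarrow> (nat \<Rightarrow> nat) \<Rightarrow> nat" where
  "pattern_count k v n \<pi> =
     card {S. S \<subseteq> {..<n} \<and> card S = k \<and>
        (\<forall>a<k. \<forall>b<k. \<pi> (sorted_list_of_set S ! a) < \<pi> (sorted_list_of_set S ! b) \<longleftrightarrow> v a < v b)}"

definition permuton :: "(real \<times> real) measure \<Rightarrow> bool" where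
  "permuton \<mu> \<longleftrightarrow> prob_space \<mu> \<and> sets \<mu> = sets borel \<and>
     distr \<mu> borel fst = restrict_space lborel {0..1} \<and>
     distr \<mu> borel snd = restrict_space lborel {0..1}"

definition sample_pattern :: "nat \<Rightarrow> (nat \<Rightarrow> real \<times> real) \<Rightarrow> (nat \<Rightarrow> nat) \<Rightarrow> bool" where
  "sample_pattern k p v \<longleftrightarrow>
     (\<exists>\<sigma>. \<sigma> permutes {..<k} \<and>
        (\<forall>a<k. \<forall>b<k. a < b \<longrightarrow> fst (p (\<sigma> a)) < fst (p (\<sigma> b))) \<and>
        (\<forall>a<k. \<forall>b<k. snd (p (\<sigma> a)) < snd (p (\<sigma> b)) \<longleftrightarrow> v a < v b))"

definition permuton_pattern_prob :: "(real \<times> real) measure \<Rightarrow> nat \<Rightarrow> (nat \<Rightarrow> nat) \<Rightarrow> real" where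
  "permuton_pattern_prob \<mu> k v =
     measure (PiM {..<k} (\<lambda>_. \<mu>)) {p \<in> space (PiM {..<k} (\<lambda>_. \<mu>)). sample_pattern k p v}"

definition unif_square :: "(real \<times> real) measure" where
  "unif_square = density lborel (indicator ({0..1} \<times> {0..1}))"

definition unif_diag :: "(real \<times> real) measure" where
  "unif_diag = distr (restrict_space lborel {0..1::real}) borel (\<lambda>x. (x, x))"

definition mu_alpha :: "real \<Rightarrow> (real \<times> real) measure" where
  "mu_alpha \<alpha> = measure_of UNIV (sets borel)
     (\<lambda>A. ennreal (1 - \<alpha>) * emeasure unif_square A + ennreal \<alpha> * emeasure unif_diag A)"

end

(* Label [n] by i.i.d. uniform variables U_1, ..., U_n. Conjugating a permutation pi by the ranks of
   the labels yields the permutation drawn by the points (U_i, U_(pi i)), and by conjugacy invariance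
   this does not change the law of Sigma_n. For a fixed pi, the points with indices in a k-set
   containing no two distinct elements of a common arc {i, pi i} are independent: fixed points are
   uniform on the diagonal and all others uniform on the square, exactly as in the mixture mu_alpha.
   All but O(n^(2k-1)) pairs of k-tuples are of this kind and have no common arc, so the pattern
   density has variance O(1/n) and its mean is, up to that error, a polynomial in the proportion of
   fixed points, which tends to alpha. *)

theory Submission
  imports Defs "HOL-Real_Asymp.Real_Asymp"
begin

section \<open>Mixtures of product measures\<close>

text \<open>All n^k index tuples, in every order and with repetitions, stand in for the k-sets. The
  tuples whose slots holding fixed points form a given set A are then a product set, so the average
  of their reference values is exactly a Bernstein-type polynomial at m/n. The limit probability is
  the same polynomial at alpha, because a product of mixtures is a mixture of products, and
  convergence of the mean becomes continuity. Repetitions cost something twice: such tuples count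
  among those with meeting arcs, and n^k must be compared with k! * (n choose k).

  Each tuple is centred at its reference value and not at its true mean, so one second moment
  controls bias and variance together.

  The labels and Sigma_n live on different probability spaces, and no joint law is built: for each
  fixed injective labelling, conjugacy invariance gives an identity between finite sums over
  permutations, which is then integrated over the labels. The proportion of fixed points is still
  random for each n, so its deviation stays in the bound until dominated convergence removes
  it.\<close>

definition unif01 :: "real measure" where
  "unif01 = density lborel (indicator {0..1})"

lemma prob_space_unif01: "prob_space unif01"
  by (rule prob_spaceI) (simp add: unif01_def emeasure_density)

lemma sets_unif01 [measurable_cong]: "sets unif01 = sets borel"
  by (simp add: unif01_def)

lemma space_unif01 [simp]: "space unif01 = UNIV"
  by (simp add: unif01_def)

lemma AE_unif01_neq: "AE x in unif01. x \<noteq> c"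
  unfolding unif01_def using AE_lborel_singleton[of c]
  by (subst AE_density) auto

lemma unif_square_eq: "unif_square = unif01 \<Otimes>\<^sub>M unif01"
proof -
  interpret prob_space unif01 by (rule prob_space_unif01)
  have "unif01 \<Otimes>\<^sub>M unif01 =
     density (lborel \<Otimes>\<^sub>M lborel) (\<lambda>(x, y). indicator {0..1} x * indicator {0..1} y)"
    unfolding unif01_def
    by (rule pair_measure_density)
       (use sigma_finite_measure_axioms in \<open>auto simp: unif01_def lborel.sigma_finite_measure_axioms\<close>)
  also have "(\<lambda>(x, y). indicator {0..1} x * indicator {0..1} y) =
      (indicator ({0..1::real} \<times> {0..1::real}) :: real \<times> real \<Rightarrow> ennreal)"
    by (auto simp: fun_eq_iff indicator_def)
  finally show ?thesis
    by (simp add: unif_square_def lborel_prod)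
qed

text \<open>The given diagonal measure comes from a restricted space whose points lie in [0,1] only.
  Replacing it by a density on the whole line turns the intersection with [0,1] into a factor of the
  integrand and lets \<open>unif01\<close> serve as the one source of randomness.\<close>

lemma unif_diag_eq: "unif_diag = distr unif01 borel (\<lambda>x. (x, x))"
proof (rule measure_eqI)
  fix A assume "A \<in> sets unif_diag"
  then have A: "A \<in> sets borel" by (simp add: unif_diag_def)
  have m: "(\<lambda>x::real. (x, x)) \<in> borel_measurable borel" by measurable
  have B: "(\<lambda>x::real. (x, x)) -` A \<in> sets borel"
    using measurable_sets[OF m A] by simp
  have m': "(\<lambda>x::real. (x, x)) \<in> borel_measurable (restrict_space lborel {0..1})"
    by (intro measurable_restrict_space1) simp
  have "emeasure unif_diag A = emeasure lborel ((\<lambda>x. (x, x)) -` A \<inter> {0..1})"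
    unfolding unif_diag_def using A m'
    by (subst emeasure_distr) (auto simp: emeasure_restrict_space space_restrict_space)
  also have "\<dots> = emeasure unif01 ((\<lambda>x. (x, x)) -` A)"
    using B unfolding unif01_def
    by (subst emeasure_density) (auto simp: indicator_inter_arith[symmetric] Int_commute mult.commute)
  also have "\<dots> = emeasure (distr unif01 borel (\<lambda>x. (x, x))) A"
    using A by (subst emeasure_distr) (auto simp: unif01_def)
  finally show "emeasure unif_diag A = emeasure (distr unif01 borel (\<lambda>x. (x, x))) A" .
qed (simp add: unif_diag_def)

lemma sets_unif_square [measurable_cong]: "sets unif_square = sets borel"
  by (simp add: unif_square_def)

lemma sets_unif_diag [measurable_cong]: "sets unif_diag = sets borel"
  by (simp add: unif_diag_def)

lemma prob_space_unif_square: "prob_space unif_square"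
  unfolding unif_square_eq by (intro prob_space_pair prob_space_unif01)

lemma prob_space_unif_diag: "prob_space unif_diag"
  unfolding unif_diag_eq
  by (rule prob_space.prob_space_distr[OF prob_space_unif01]) (simp add: unif01_def)

text \<open>\<open>measure_of\<close> takes the intended values only once countable additivity is
  known; here a finite sum is exchanged with a series. \<open>N0\<close> just supplies the space and
  the sigma-algebra. The lemma serves both for \<open>mu_alpha\<close>, a sum over two booleans, and
  for mixtures of product measures, a sum over subsets.\<close>

lemma emeasure_weighted_sum:
  fixes c :: "'i \<Rightarrow> ennreal" and N :: "'i \<Rightarrow> 'a measure"
  assumes "finite I" "\<And>i. i \<in> I \<Longrightarrow> sets (N i) = sets N0" "A \<in> sets N0"
  shows "emeasure (measure_of (space N0) (sets N0) (\<lambda>A. \<Sum>i\<in>I. c i * emeasure (N i) A)) A =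
    (\<Sum>i\<in>I. c i * emeasure (N i) A)"
proof (rule emeasure_measure_of[OF refl])
  show "countably_additive (sets (measure_of (space N0) (sets N0) (\<lambda>A. \<Sum>i\<in>I. c i * emeasure (N i) A)))
     (\<lambda>A. \<Sum>i\<in>I. c i * emeasure (N i) A)"
  proof (rule countably_additiveI)
    fix B :: "nat \<Rightarrow> 'a set"
    assume "range B \<subseteq> sets (measure_of (space N0) (sets N0) (\<lambda>A. \<Sum>i\<in>I. c i * emeasure (N i) A))"
      and d: "disjoint_family B"
    then have B: "range B \<subseteq> sets N0" by (simp add: sets.space_closed)
    have "(\<Sum>j. \<Sum>i\<in>I. c i * emeasure (N i) (B j)) = (\<Sum>i\<in>I. \<Sum>j. c i * emeasure (N i) (B j))"
      by (rule suminf_sum) simp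
    also have "\<dots> = (\<Sum>i\<in>I. c i * emeasure (N i) (\<Union> (range B)))"
      using B d assms(2) by (intro sum.cong) (auto simp: suminf_emeasure)
    finally show "(\<Sum>j. \<Sum>i\<in>I. c i * emeasure (N i) (B j)) = (\<Sum>i\<in>I. c i * emeasure (N i) (\<Union> (range B)))" .
  qed
qed (use assms in \<open>auto simp: positive_def sets.space_closed\<close>)

lemma sets_mu_alpha [measurable_cong]: "sets (mu_alpha \<alpha>) = sets borel"
  using sets.space_closed[of "borel :: (real \<times> real) measure"]
  by (simp add: mu_alpha_def sets.sigma_sets_eq[of "borel :: (real \<times> real) measure", simplified])

lemma emeasure_mu_alpha:
  assumes "A \<in> sets borel"
  shows "emeasure (mu_alpha \<alpha>) A =
    ennreal (1 - \<alpha>) * emeasure unif_square A + ennreal \<alpha> * emeasure unif_diag A"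
  using emeasure_weighted_sum[of "UNIV :: bool set" "\<lambda>b. if b then unif_diag else unif_square" borel A
      "\<lambda>b. if b then ennreal \<alpha> else ennreal (1 - \<alpha>)"] assms
  by (simp add: mu_alpha_def UNIV_bool sets_unif_square sets_unif_diag)

lemma prob_space_mu_alpha:
  assumes "\<alpha> \<in> {0..1}"
  shows "prob_space (mu_alpha \<alpha>)"
proof (rule prob_spaceI)
  have "space (mu_alpha \<alpha>) = UNIV"
    using sets_eq_imp_space_eq[OF sets_mu_alpha] by simp
  moreover have "space unif_square = UNIV" "space unif_diag = UNIV"
    by (simp_all add: unif_square_def unif_diag_def)
  moreover have "ennreal (1 - \<alpha>) + ennreal \<alpha> = 1"
    using assms by (subst ennreal_plus[symmetric]) auto
  ultimately show "emeasure (mu_alpha \<alpha>) (space (mu_alpha \<alpha>)) = 1"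
    using prob_space.emeasure_space_1[OF prob_space_unif_square]
      prob_space.emeasure_space_1[OF prob_space_unif_diag]
    by (simp add: emeasure_mu_alpha)
qed

abbreviation point_law :: "bool \<Rightarrow> (real \<times> real) measure" where
  "point_law b \<equiv> (if b then unif_diag else unif_square)"

lemma product_prob_point_law: "product_prob_space (\<lambda>j. point_law (P j))"
  by (rule product_prob_spaceI) (simp add: prob_space_unif_diag prob_space_unif_square)

lemma sets_PiM_point_law:
  "sets (PiM J (\<lambda>j. point_law (P j))) = sets (PiM J (\<lambda>_. borel))"
  by (rule sets_PiM_cong) (auto simp: sets_unif_diag sets_unif_square)

text \<open>Each coordinate is drawn from the diagonal or from the square, and \<open>A\<close>
  collects those drawn from the diagonal. A finite product measure is determined by its values on
  boxes, and on a box the claim is the expansion of a product of binomials into a sum over subsets,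
  \<open>prod_add\<close>.\<close>

lemma emeasure_PiM_mu_alpha:
  assumes \<alpha>: "\<alpha> \<in> {0..1}" and [simp]: "finite J" and S: "S \<in> sets (PiM J (\<lambda>_. borel))"
  shows "emeasure (PiM J (\<lambda>_. mu_alpha \<alpha>)) S =
    (\<Sum>A\<in>Pow J. ennreal (\<alpha> ^ card A * (1 - \<alpha>) ^ card (J - A)) *
       emeasure (PiM J (\<lambda>j. point_law (j \<in> A))) S)"
proof -
  interpret mu: prob_space "mu_alpha \<alpha>" by (rule prob_space_mu_alpha[OF \<alpha>])
  interpret prod: product_prob_space "\<lambda>_. mu_alpha \<alpha>" J
    by (rule product_prob_spaceI) (rule prob_space_mu_alpha[OF \<alpha>])
  define N0 :: "('a \<Rightarrow> real \<times> real) measure" where "N0 = PiM J (\<lambda>_. borel)"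
  define c where "c A = ennreal (\<alpha> ^ card A * (1 - \<alpha>) ^ card (J - A))" for A
  define N where "N A = PiM J (\<lambda>j. point_law (j \<in> A))" for A
  let ?P = "measure_of (space N0) (sets N0) (\<lambda>S. \<Sum>A\<in>Pow J. c A * emeasure (N A) S)"
  have setsN: "sets (N A) = sets N0" for A
    by (simp add: N_def N0_def sets_PiM_point_law)
  have "?P = PiM J (\<lambda>_. mu_alpha \<alpha>)"
  proof (rule prod.PiM_eqI)
    show "sets ?P = sets (PiM J (\<lambda>_. mu_alpha \<alpha>))"
      using sets.space_closed[of N0]
      by (simp add: sets.sigma_sets_eq) (auto simp: N0_def sets_mu_alpha intro!: sets_PiM_cong)
  next
    fix B assume "\<And>i. i \<in> J \<Longrightarrow> B i \<in> sets (mu_alpha \<alpha>)"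
    then have B: "\<And>i. i \<in> J \<Longrightarrow> B i \<in> sets borel" by (simp add: sets_mu_alpha)
    have "emeasure ?P (Pi\<^sub>E J B) = (\<Sum>A\<in>Pow J. c A * emeasure (N A) (Pi\<^sub>E J B))"
      by (rule emeasure_weighted_sum) (use B in \<open>auto simp: setsN N0_def intro!: sets_PiM_I_finite\<close>)
    also have "\<dots> = (\<Sum>A\<in>Pow J. (\<Prod>j\<in>A. ennreal \<alpha> * emeasure unif_diag (B j)) *
        (\<Prod>j\<in>J - A. ennreal (1 - \<alpha>) * emeasure unif_square (B j)))"
    proof (rule sum.cong[OF refl])
      fix A assume A: "A \<in> Pow J"
      then have fA: "finite A" using finite_subset[of A J] by auto
      interpret pl: product_prob_space "\<lambda>j. point_law (j \<in> A)" J by (rule product_prob_point_law)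
      have "emeasure (N A) (Pi\<^sub>E J B) = (\<Prod>j\<in>J. emeasure (point_law (j \<in> A)) (B j))"
        unfolding N_def using B by (subst pl.emeasure_PiM) (auto simp: sets_unif_diag sets_unif_square)
      also have "\<dots> = (\<Prod>j\<in>A. emeasure (point_law (j \<in> A)) (B j)) * (\<Prod>j\<in>J-A. emeasure (point_law (j \<in> A)) (B j))"
        using A by (subst prod.subset_diff[of A J]) (auto simp: mult.commute)
      also have "\<dots> = (\<Prod>j\<in>A. emeasure unif_diag (B j)) * (\<Prod>j\<in>J-A. emeasure unif_square (B j))"
        by simp
      finally show "c A * emeasure (N A) (Pi\<^sub>E J B) = (\<Prod>j\<in>A. ennreal \<alpha> * emeasure unif_diag (B j)) *
        (\<Prod>j\<in>J - A. ennreal (1 - \<alpha>) * emeasure unif_square (B j))"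
        using \<alpha> by (simp add: c_def prod.distrib ennreal_mult ennreal_power mult_ac)
    qed
    also have "\<dots> = (\<Prod>j\<in>J. ennreal \<alpha> * emeasure unif_diag (B j) + ennreal (1 - \<alpha>) * emeasure unif_square (B j))"
      by (rule prod_add[symmetric]) simp
    also have "\<dots> = (\<Prod>j\<in>J. emeasure (mu_alpha \<alpha>) (B j))"
      using B by (intro prod.cong) (auto simp: emeasure_mu_alpha add.commute)
    finally show "emeasure ?P (Pi\<^sub>E J B) = (\<Prod>j\<in>J. emeasure (mu_alpha \<alpha>) (B j))" .
  qed simp
  moreover have "emeasure ?P S = (\<Sum>A\<in>Pow J. c A * emeasure (N A) S)"
    by (rule emeasure_weighted_sum) (use S in \<open>auto simp: setsN N0_def\<close>)
  ultimately show ?thesis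
    by (simp add: N_def c_def)
qed

section \<open>Patterns of points with i.i.d. labels\<close>

text \<open>The existential in \<open>sample_pattern\<close> ranges over the finitely many
  permutations of \<open>{..<k}\<close>, so the event is a finite Boolean combination of comparisons
  of coordinates.\<close>

lemma pred_sample_pattern:
  assumes X: "\<And>j. j < k \<Longrightarrow> X j \<in> borel_measurable N"
  shows "Measurable.pred N (\<lambda>x. sample_pattern k (\<lambda>j. X j x) v)"
proof -
  have fin: "finite {\<sigma>. \<sigma> permutes {..<k}}" by (simp add: finite_permutations)
  have 1: "Measurable.pred N (\<lambda>x. (\<forall>a\<in>{..<k}. \<forall>b\<in>{..<k}. a < b \<longrightarrow> fst (X (\<sigma> a) x) < fst (X (\<sigma> b) x)) \<and>
       (\<forall>a\<in>{..<k}. \<forall>b\<in>{..<k}. snd (X (\<sigma> a) x) < snd (X (\<sigma> b) x) \<longleftrightarrow> v a < v b))"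
    if "\<sigma> permutes {..<k}" for \<sigma>
  proof -
    have X': "X (\<sigma> a) \<in> borel_measurable N" if "a \<in> {..<k}" for a
      using that \<open>\<sigma> permutes {..<k}\<close> X permutes_in_image by fastforce
    have "(\<lambda>x. fst (X (\<sigma> a) x)) \<in> borel_measurable N" "(\<lambda>x. snd (X (\<sigma> a) x)) \<in> borel_measurable N"
      if "a \<in> {..<k}" for a
      by (auto intro!: measurable_compose[OF X'[OF that]] borel_measurable_continuous_onI continuous_intros)
    then have "Measurable.pred N (\<lambda>x. fst (X (\<sigma> a) x) < fst (X (\<sigma> b) x))"
      "Measurable.pred N (\<lambda>x. snd (X (\<sigma> a) x) < snd (X (\<sigma> b) x))"
      if "a \<in> {..<k}" "b \<in> {..<k}" for a b
      using that by (auto intro!: borel_measurable_pred_less)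
    then show ?thesis
      by (intro pred_intros_logic pred_intros_finite) auto
  qed
  have "Measurable.pred N (\<lambda>x. \<exists>\<sigma>\<in>{\<sigma>. \<sigma> permutes {..<k}}.
     (\<forall>a\<in>{..<k}. \<forall>b\<in>{..<k}. a < b \<longrightarrow> fst (X (\<sigma> a) x) < fst (X (\<sigma> b) x)) \<and>
       (\<forall>a\<in>{..<k}. \<forall>b\<in>{..<k}. snd (X (\<sigma> a) x) < snd (X (\<sigma> b) x) \<longleftrightarrow> v a < v b))"
    by (rule pred_intros_finite(4)[OF fin]) (rule 1, simp)
  moreover have "sample_pattern k (\<lambda>j. X j x) v \<longleftrightarrow> (\<exists>\<sigma>\<in>{\<sigma>. \<sigma> permutes {..<k}}.
     (\<forall>a\<in>{..<k}. \<forall>b\<in>{..<k}. a < b \<longrightarrow> fst (X (\<sigma> a) x) < fst (X (\<sigma> b) x)) \<and>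
       (\<forall>a\<in>{..<k}. \<forall>b\<in>{..<k}. snd (X (\<sigma> a) x) < snd (X (\<sigma> b) x) \<longleftrightarrow> v a < v b))" for x
    unfolding sample_pattern_def Ball_def Bex_def lessThan_iff mem_Collect_eq ..
  ultimately show ?thesis by simp
qed

lemma sample_pattern_cong:
  assumes "\<And>j. j < k \<Longrightarrow> p j = p' j"
  shows "sample_pattern k p v = sample_pattern k p' v"
proof -
  have "p (\<sigma> a) = p' (\<sigma> a)" if "\<sigma> permutes {..<k}" "a < k" for \<sigma> a
    using that assms[of "\<sigma> a"] permutes_in_image[of \<sigma> "{..<k}" a] by auto
  then show ?thesis
    unfolding sample_pattern_def by (intro ex_cong1) auto
qed

text \<open>The probability of \<open>v\<close> given that \<open>A\<close> is the set of samples
  drawn from the diagonal. It is also the reference value at which an index tuple with fixed slots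
  \<open>A\<close> is centred.\<close>

definition pattern_prob_on_diag :: "nat \<Rightarrow> (nat \<Rightarrow> nat) \<Rightarrow> nat set \<Rightarrow> real" where
  "pattern_prob_on_diag k v A = measure (PiM {..<k} (\<lambda>j. point_law (j \<in> A)))
     {p \<in> space (PiM {..<k} (\<lambda>_. borel)). sample_pattern k p v}"

lemma sample_pattern_event:
  "{p \<in> space (PiM {..<k} (\<lambda>_. borel)). sample_pattern k p v} \<in> sets (PiM {..<k} (\<lambda>_. borel))"
  using pred_sample_pattern[of k "\<lambda>j p. p j" "PiM {..<k} (\<lambda>_. borel)" v] by simp

lemma pattern_prob_on_diag_bounds:
  "0 \<le> pattern_prob_on_diag k v A" "pattern_prob_on_diag k v A \<le> 1"
proof -
  interpret product_prob_space "\<lambda>j. point_law (j \<in> A)" "{..<k}" by (rule product_prob_point_law)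
  show "0 \<le> pattern_prob_on_diag k v A" "pattern_prob_on_diag k v A \<le> 1"
    by (auto simp: pattern_prob_on_diag_def)
qed

definition mixed_pattern_prob :: "nat \<Rightarrow> (nat \<Rightarrow> nat) \<Rightarrow> real \<Rightarrow> real" where
  "mixed_pattern_prob k v \<alpha> =
    (\<Sum>A\<in>Pow {..<k}. \<alpha> ^ card A * (1 - \<alpha>) ^ card ({..<k} - A) * pattern_prob_on_diag k v A)"

lemma permuton_pattern_prob_mu_alpha:
  assumes \<alpha>: "\<alpha> \<in> {0..1}"
  shows "permuton_pattern_prob (mu_alpha \<alpha>) k v = mixed_pattern_prob k v \<alpha>"
proof -
  let ?S = "{p \<in> space (PiM {..<k} (\<lambda>_. borel)). sample_pattern k p v}"
  have sp: "space (PiM {..<k} (\<lambda>_. mu_alpha \<alpha>)) = space (PiM {..<k} (\<lambda>_. borel))"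
    by (intro sets_eq_imp_space_eq sets_PiM_cong sets_mu_alpha refl)
  have "emeasure (PiM {..<k} (\<lambda>_. mu_alpha \<alpha>)) ?S =
     (\<Sum>A\<in>Pow {..<k}. ennreal (\<alpha> ^ card A * (1 - \<alpha>) ^ card ({..<k} - A)) *
       emeasure (PiM {..<k} (\<lambda>j. point_law (j \<in> A))) ?S)"
    by (rule emeasure_PiM_mu_alpha[OF \<alpha> _ sample_pattern_event]) simp
  also have "\<dots> = (\<Sum>A\<in>Pow {..<k}. ennreal (\<alpha> ^ card A * (1 - \<alpha>) ^ card ({..<k} - A) * pattern_prob_on_diag k v A))"
  proof (rule sum.cong[OF refl])
    fix A
    interpret product_prob_space "\<lambda>j. point_law (j \<in> A)" "{..<k}" by (rule product_prob_point_law)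
    show "ennreal (\<alpha> ^ card A * (1 - \<alpha>) ^ card ({..<k} - A)) *
       emeasure (PiM {..<k} (\<lambda>j. point_law (j \<in> A))) ?S =
       ennreal (\<alpha> ^ card A * (1 - \<alpha>) ^ card ({..<k} - A) * pattern_prob_on_diag k v A)"
      using \<alpha> by (simp add: pattern_prob_on_diag_def P.emeasure_eq_measure ennreal_mult)
  qed
  also have "\<dots> = ennreal (mixed_pattern_prob k v \<alpha>)"
    unfolding mixed_pattern_prob_def using \<alpha>
    by (intro sum_ennreal mult_nonneg_nonneg) (auto simp: pattern_prob_on_diag_bounds)
  finally show ?thesis
    unfolding permuton_pattern_prob_def sp
    using \<alpha> by (subst measure_def) (auto simp: mixed_pattern_prob_def pattern_prob_on_diag_bounds
        intro!: enn2real_ennreal sum_nonneg mult_nonneg_nonneg)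
qed

section \<open>Independent uniform labels and the points they draw\<close>

definition iid_unif :: "(nat \<Rightarrow> real) measure" where
  "iid_unif = PiM UNIV (\<lambda>_. unif01)"

lemma prob_space_iid_unif: "prob_space iid_unif"
  unfolding iid_unif_def by (rule prob_space_PiM) (rule prob_space_unif01)

interpretation iid: prob_space iid_unif by (rule prob_space_iid_unif)

lemma space_iid_unif [simp]: "space iid_unif = UNIV"
  by (simp add: iid_unif_def space_PiM PiE_def Pi_def)

lemma iid_unif_component [measurable]: "(\<lambda>\<omega>. \<omega> i) \<in> borel_measurable iid_unif"
proof -
  have "(\<lambda>\<omega>. \<omega> i) \<in> measurable iid_unif unif01"
    unfolding iid_unif_def by (rule measurable_component_singleton) simp
  then show ?thesis by (simp add: measurable_cong_sets[OF refl sets_unif01])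
qed

lemma distr_iid_unif_component: "distr iid_unif borel (\<lambda>\<omega>. \<omega> i) = unif01"
proof -
  have "distr iid_unif borel (\<lambda>\<omega>. \<omega> i) = distr iid_unif unif01 (\<lambda>\<omega>. \<omega> i)"
    by (rule distr_cong) (auto simp: sets_unif01)
  also have "\<dots> = unif01"
    unfolding iid_unif_def by (rule distr_PiM_component) (auto simp: prob_space_unif01)
  finally show ?thesis .
qed

lemma indep_iid_unif: "iid.indep_vars (\<lambda>_. borel) (\<lambda>i \<omega>. \<omega> i) UNIV"
proof (subst iid.indep_vars_iff_distr_eq_PiM')
  have "distr iid_unif (PiM UNIV (\<lambda>_. borel)) (\<lambda>x. \<lambda>i\<in>UNIV. x i) = distr iid_unif iid_unif (\<lambda>x. x)"
    by (rule distr_cong) (auto simp: iid_unif_def intro!: sets_PiM_cong simp: sets_unif01)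
  then show "distr iid_unif (PiM UNIV (\<lambda>_. borel)) (\<lambda>x. \<lambda>i\<in>UNIV. x i) =
     PiM UNIV (\<lambda>i. distr iid_unif borel (\<lambda>\<omega>. \<omega> i))"
    by (simp add: distr_iid_unif_component distr_id2) (simp add: iid_unif_def)
qed auto

lemma distr_iid_unif_pair: "distr iid_unif borel (\<lambda>\<omega>. (\<omega> a, \<omega> b)) = point_law (a = b)"
proof (cases "a = b")
  case True
  have "distr (distr iid_unif borel (\<lambda>\<omega>. \<omega> a)) borel (\<lambda>x. (x, x)) = distr iid_unif borel (\<lambda>\<omega>. (\<omega> a, \<omega> a))"
    by (subst distr_distr) (auto simp: o_def)
  then show ?thesis
    using True by (simp add: distr_iid_unif_component unif_diag_eq)
next
  case False
  have "iid.indep_var borel (\<lambda>\<omega>. \<omega> a) borel (\<lambda>\<omega>. \<omega> b)"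
    using iid.indep_var_compose[OF iid.indep_var_restrict[OF indep_iid_unif, of "{a}" "{b}"],
        of "\<lambda>f. f a" borel "\<lambda>f. f b" borel] False
    by (simp add: o_def)
  then have "unif01 \<Otimes>\<^sub>M unif01 = distr iid_unif (borel \<Otimes>\<^sub>M borel) (\<lambda>\<omega>. (\<omega> a, \<omega> b))"
    by (simp add: iid.indep_var_distribution_eq distr_iid_unif_component)
  then show ?thesis
    using False by (simp add: unif_square_eq borel_prod)
qed

text \<open>Disjoint blocks \<open>{a j, b j}\<close> of labels are independent, hence so are the
  points read from them; inside a block only the question whether the two labels coincide
  matters.\<close>

lemma distr_iid_unif_pairs:
  assumes "J \<noteq> {}"
    and disj: "\<And>i j. i \<in> J \<Longrightarrow> j \<in> J \<Longrightarrow> i \<noteq> j \<Longrightarrow> {a i, b i} \<inter> {a j, b j} = {}"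
  shows "distr iid_unif (PiM J (\<lambda>_. borel)) (\<lambda>\<omega>. \<lambda>j\<in>J. (\<omega> (a j), \<omega> (b j))) =
    PiM J (\<lambda>j. point_law (a j = b j))"
proof -
  have "iid.indep_vars (\<lambda>j. PiM {a j, b j} (\<lambda>_. borel)) (\<lambda>j \<omega>. restrict (\<lambda>i. \<omega> i) {a j, b j}) J"
    by (rule iid.indep_vars_restrict[OF indep_iid_unif]) (use disj in \<open>auto simp: disjoint_family_on_def\<close>)
  then have "iid.indep_vars (\<lambda>_. borel) (\<lambda>j \<omega>. (restrict (\<lambda>i. \<omega> i) {a j, b j} (a j), restrict (\<lambda>i. \<omega> i) {a j, b j} (b j))) J"
    by (rule iid.indep_vars_compose2[where Y = "\<lambda>j x. (x (a j), x (b j))"])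
       (auto simp flip: borel_prod intro!: measurable_Pair measurable_component_singleton)
  then have "iid.indep_vars (\<lambda>_. borel) (\<lambda>j \<omega>. (\<omega> (a j), \<omega> (b j))) J"
    by simp
  then show ?thesis
    using assms(1) by (subst (asm) iid.indep_vars_iff_distr_eq_PiM') (auto simp: distr_iid_unif_pair)
qed

text \<open>The tuple \<open>t\<close> may be unsorted and may repeat indices. Since
  \<open>sample_pattern\<close> sorts the points by a strict order on first coordinates, all
  \<open>k!\<close> orderings of a set get the same value, and a tuple with a repeated index gets 0.
  Taking \<open>real\<close> for \<open>\<omega>\<close> gives the pattern of the permutation
  itself.\<close>

definition pattern_at :: "nat \<Rightarrow> (nat \<Rightarrow> nat) \<Rightarrow> (nat \<Rightarrow> nat) \<Rightarrow> (nat \<Rightarrow> nat) \<Rightarrow> (nat \<Rightarrow> real) \<Rightarrow> real" where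
  "pattern_at k v \<pi> t \<omega> = of_bool (sample_pattern k (\<lambda>j. (\<omega> (t j), \<omega> (\<pi> (t j)))) v)"

lemma pattern_at_bounds: "0 \<le> pattern_at k v \<pi> t \<omega>" "pattern_at k v \<pi> t \<omega> \<le> 1"
  by (auto simp: pattern_at_def)

lemma pred_pattern_PiM:
  assumes "t ` {..<k} \<union> \<pi> ` t ` {..<k} \<subseteq> I"
  shows "Measurable.pred (PiM I (\<lambda>_. borel)) (\<lambda>\<omega>. sample_pattern k (\<lambda>j. (\<omega> (t j), \<omega> (\<pi> (t j))) :: real \<times> real) v)"
proof (rule pred_sample_pattern)
  fix j assume "j < k"
  then have "t j \<in> I" "\<pi> (t j) \<in> I" using assms by auto
  then show "(\<lambda>\<omega>. (\<omega> (t j), \<omega> (\<pi> (t j))) :: real \<times> real) \<in> borel_measurable (PiM I (\<lambda>_. borel))"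
    unfolding borel_prod[symmetric] by (intro measurable_Pair measurable_component_singleton)
qed

lemma borel_measurable_of_pred:
  assumes "Measurable.pred N P"
  shows "(\<lambda>x. of_bool (P x) :: real) \<in> borel_measurable N"
  using assms unfolding of_bool_def by measurable

lemma measurable_pattern_at_PiM:
  assumes "t ` {..<k} \<union> \<pi> ` t ` {..<k} \<subseteq> I"
  shows "pattern_at k v \<pi> t \<in> borel_measurable (PiM I (\<lambda>_. borel))"
  unfolding pattern_at_def using pred_pattern_PiM[OF assms] by (rule borel_measurable_of_pred)

lemma pred_pattern_iid:
  "Measurable.pred iid_unif (\<lambda>\<omega>. sample_pattern k (\<lambda>j. (\<omega> (t j), \<omega> (\<pi> (t j)))) v)"
proof (rule pred_sample_pattern)
  show "(\<lambda>\<omega>. (\<omega> (t j), \<omega> (\<pi> (t j)))) \<in> borel_measurable iid_unif" for j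
    unfolding borel_prod[symmetric] by (intro measurable_Pair iid_unif_component)
qed

lemma measurable_pattern_at [measurable]: "pattern_at k v \<pi> t \<in> borel_measurable iid_unif"
  unfolding pattern_at_def using pred_pattern_iid by (rule borel_measurable_of_pred)

lemma integrable_pattern_at: "integrable iid_unif (pattern_at k v \<pi> t)"
  by (rule iid.integrable_const_bound[where B = 1]) (auto simp: pattern_at_def)

text \<open>These are the labels that the point drawn at index \<open>x\<close> depends on; a fixed
  point depends on a single one.\<close>

definition arc :: "('i \<Rightarrow> 'i) \<Rightarrow> 'i \<Rightarrow> 'i set" where
  "arc \<pi> x = {x, \<pi> x}"

definition fixed_slots :: "nat \<Rightarrow> (nat \<Rightarrow> nat) \<Rightarrow> (nat \<Rightarrow> nat) \<Rightarrow> nat set" where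
  "fixed_slots k \<pi> t = {j \<in> {..<k}. \<pi> (t j) = t j}"

lemma expectation_pattern_at:
  assumes "k \<ge> 1"
    and disj: "\<And>i j. i < k \<Longrightarrow> j < k \<Longrightarrow> i \<noteq> j \<Longrightarrow> arc \<pi> (t i) \<inter> arc \<pi> (t j) = {}"
  shows "iid.expectation (pattern_at k v \<pi> t) = pattern_prob_on_diag k v (fixed_slots k \<pi> t)"
proof -
  let ?S = "{p \<in> space (PiM {..<k} (\<lambda>_. borel)). sample_pattern k p v}"
  let ?X = "\<lambda>\<omega>. \<lambda>j\<in>{..<k}. (\<omega> (t j), \<omega> (\<pi> (t j)))"
  have mX: "?X \<in> measurable iid_unif (PiM {..<k} (\<lambda>_. borel))"
    unfolding borel_prod[symmetric] by (intro measurable_restrict measurable_Pair iid_unif_component)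
  have "distr iid_unif (PiM {..<k} (\<lambda>_. borel)) ?X = PiM {..<k} (\<lambda>j. point_law (t j = \<pi> (t j)))"
    by (rule distr_iid_unif_pairs) (use assms in \<open>auto simp: arc_def lessThan_empty_iff\<close>)
  also have "\<dots> = PiM {..<k} (\<lambda>j. point_law (j \<in> fixed_slots k \<pi> t))"
    by (rule PiM_cong) (auto simp: fixed_slots_def)
  finally have "pattern_prob_on_diag k v (fixed_slots k \<pi> t) =
      measure (distr iid_unif (PiM {..<k} (\<lambda>_. borel)) ?X) ?S"
    by (simp add: pattern_prob_on_diag_def)
  also have "\<dots> = iid.prob (?X -` ?S \<inter> space iid_unif)"
    by (rule measure_distr[OF mX sample_pattern_event])
  also have "?X -` ?S \<inter> space iid_unif = {\<omega>. sample_pattern k (\<lambda>j. (\<omega> (t j), \<omega> (\<pi> (t j)))) v}"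
    using sample_pattern_cong[of k "?X _" "\<lambda>j. (_ (t j), _ (\<pi> (t j)))" v]
    by (auto simp: space_PiM)
  also have "iid.prob \<dots> = iid.expectation (indicator {\<omega>. sample_pattern k (\<lambda>j. (\<omega> (t j), \<omega> (\<pi> (t j)))) v})"
    by simp
  also have "\<dots> = iid.expectation (pattern_at k v \<pi> t)"
    by (rule Bochner_Integration.integral_cong) (auto simp: pattern_at_def indicator_def)
  finally show ?thesis ..
qed

text \<open>The two indicators read disjoint sets of labels. Arcs inside one tuple may still meet,
  and \<open>c\<close>, \<open>d\<close> are arbitrary, so that the tuples can be centred at
  reference values which need not be their means.\<close>

lemma pattern_at_indep:
  assumes "\<And>i j. i < k \<Longrightarrow> j < k \<Longrightarrow> arc \<pi> (t i) \<inter> arc \<pi> (s j) = {}"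
  shows "iid.expectation (\<lambda>\<omega>. (pattern_at k v \<pi> t \<omega> - c) * (pattern_at k v \<pi> s \<omega> - d)) =
    (iid.expectation (pattern_at k v \<pi> t) - c) * (iid.expectation (pattern_at k v \<pi> s) - d)"
proof -
  define I where "I t = t ` {..<k} \<union> \<pi> ` t ` {..<k}" for t :: "nat \<Rightarrow> nat"
  have r: "pattern_at k v \<pi> t (restrict \<omega> (I t)) = pattern_at k v \<pi> t \<omega>" for t \<omega>
    unfolding pattern_at_def of_bool_eq_iff by (rule sample_pattern_cong) (auto simp: I_def)
  have dj: "I t \<inter> I s = {}" using assms by (fastforce simp: I_def arc_def)
  have "iid.indep_var (PiM (I t) (\<lambda>_. borel)) (\<lambda>\<omega>. restrict (\<lambda>i. \<omega> i) (I t)) (PiM (I s) (\<lambda>_. borel)) (\<lambda>\<omega>. restrict (\<lambda>i. \<omega> i) (I s))"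
    by (rule iid.indep_var_restrict[OF indep_iid_unif dj]) auto
  then have "iid.indep_var borel ((\<lambda>x. pattern_at k v \<pi> t x - c) \<circ> (\<lambda>\<omega>. restrict (\<lambda>i. \<omega> i) (I t)))
     borel ((\<lambda>x. pattern_at k v \<pi> s x - d) \<circ> (\<lambda>\<omega>. restrict (\<lambda>i. \<omega> i) (I s)))"
    by (rule iid.indep_var_compose) (auto simp: I_def intro!: borel_measurable_diff measurable_pattern_at_PiM)
  then have "iid.indep_var borel (\<lambda>x. pattern_at k v \<pi> t x - c) borel (\<lambda>x. pattern_at k v \<pi> s x - d)"
    by (simp add: o_def r)
  then have "iid.expectation (\<lambda>\<omega>. (pattern_at k v \<pi> t \<omega> - c) * (pattern_at k v \<pi> s \<omega> - d)) =
     iid.expectation (\<lambda>x. pattern_at k v \<pi> t x - c) * iid.expectation (\<lambda>x. pattern_at k v \<pi> s x - d)"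
    by (intro iid.indep_var_lebesgue_integral) (auto simp: integrable_pattern_at)
  then show ?thesis
    by (simp add: integrable_pattern_at iid.prob_space[simplified])
qed

section \<open>Counting tuples whose arcs meet\<close>

abbreviation tuples :: "nat \<Rightarrow> nat \<Rightarrow> (nat \<Rightarrow> nat) set" where
  "tuples k n \<equiv> PiE {..<k} (\<lambda>_. {..<n})"

text \<open>The other \<open>k - 1\<close> slots are free, and they leave at most \<open>c\<close>
  values for slot \<open>j\<close>. Letting \<open>R\<close> depend on those slots covers collisions
  within one tuple as well as collisions with a given second tuple, for which \<open>R\<close> is
  constant.\<close>

lemma card_tuples_hit:
  assumes j: "j < k" and R: "\<And>f. finite (R f)" "\<And>f. card (R f) \<le> c"
  shows "card {t \<in> tuples k n. t j \<in> R (restrict t ({..<k} - {j}))} \<le> c * n ^ (k - 1)"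
proof -
  let ?T = "PiE ({..<k} - {j}) (\<lambda>_. {..<n})"
  have sub: "{t \<in> tuples k n. t j \<in> R (restrict t ({..<k} - {j}))} \<subseteq> (\<lambda>(f, y). f(j := y)) ` (SIGMA f:?T. R f)"
  proof
    fix t assume t: "t \<in> {t \<in> tuples k n. t j \<in> R (restrict t ({..<k} - {j}))}"
    have "t = (restrict t ({..<k} - {j}))(j := t j)"
      using t j by (auto simp: fun_eq_iff PiE_def extensional_def)
    then show "t \<in> (\<lambda>(f, y). f(j := y)) ` (SIGMA f:?T. R f)"
      using t by (intro image_eqI[where x = "(restrict t ({..<k} - {j}), t j)"]) auto
  qed
  have fin: "finite ?T" by (intro finite_PiE) auto
  have "card {t \<in> tuples k n. t j \<in> R (restrict t ({..<k} - {j}))} \<le> card (SIGMA f:?T. R f)"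
    by (rule surj_card_le[OF _ sub]) (use fin R in auto)
  also have "\<dots> = (\<Sum>f\<in>?T. card (R f))" using fin R by simp
  also have "\<dots> \<le> card ?T * c" using R by (intro sum_bounded_above[where K = c, simplified]) auto
  also have "card ?T = n ^ (k - 1)" using j by (simp add: card_PiE)
  finally show ?thesis by (simp only: mult.commute)
qed

text \<open>There are four possible coincidences, but \<open>\<pi> x = \<pi> y\<close> already means
  \<open>x = y\<close>. The three remaining values are the origin of the factor 3 in the
  counts.\<close>

lemma arc_meet:
  assumes "inj \<pi>" "arc \<pi> x \<inter> arc \<pi> y \<noteq> {}"
  shows "y \<in> {x, \<pi> x, inv \<pi> x}"
  using assms by (auto simp: arc_def inj_eq)

lemma card_three: "card {x, y, z} \<le> 3"
  by (simp add: card_insert_if)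

lemma card_le_pairs:
  assumes "\<And>i j. i < k \<Longrightarrow> j < k \<Longrightarrow> card {t \<in> T. P i j t} \<le> (c :: nat)" "finite T"
  shows "card {t \<in> T. \<exists>i<k. \<exists>j<k. P i j t} \<le> k * k * c"
proof -
  have "{t \<in> T. \<exists>i<k. \<exists>j<k. P i j t} = (\<Union>x\<in>{..<k} \<times> {..<k}. {t \<in> T. P (fst x) (snd x) t})"
    by (auto; blast)
  also have "card \<dots> \<le> (\<Sum>x\<in>{..<k} \<times> {..<k}. card {t \<in> T. P (fst x) (snd x) t})"
    by (rule card_UN_le) simp
  also have "\<dots> \<le> card ({..<k} \<times> {..<k}) * c"
    using assms by (intro sum_bounded_above[where K = c, simplified]) auto
  finally show ?thesis by simp
qed

lemma card_tuples_cross: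
  assumes "inj \<pi>"
  shows "card {s \<in> tuples k n. \<exists>i<k. \<exists>j<k. arc \<pi> (t i) \<inter> arc \<pi> (s j) \<noteq> {}} \<le> k * k * (3 * n ^ (k - 1))"
proof (rule card_le_pairs)
  fix i j assume ij: "i < k" "j < k"
  have "card {s \<in> tuples k n. arc \<pi> (t i) \<inter> arc \<pi> (s j) \<noteq> {}}
     \<le> card {s \<in> tuples k n. s j \<in> {t i, \<pi> (t i), inv \<pi> (t i)}}"
    using arc_meet[OF assms] by (intro card_mono) (auto intro!: finite_PiE)
  also have "\<dots> \<le> 3 * n ^ (k - 1)"
    by (rule card_tuples_hit[OF ij(2)]) (auto simp: card_three)
  finally show "card {s \<in> tuples k n. arc \<pi> (t i) \<inter> arc \<pi> (s j) \<noteq> {}} \<le> 3 * n ^ (k - 1)" .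
qed (auto intro!: finite_PiE)

lemma card_tuples_self_cross:
  assumes "inj \<pi>"
  shows "card {t \<in> tuples k n. \<exists>i<k. \<exists>j<k. i \<noteq> j \<and> arc \<pi> (t i) \<inter> arc \<pi> (t j) \<noteq> {}} \<le> k * k * (3 * n ^ (k - 1))"
proof (rule card_le_pairs)
  fix i j assume ij: "i < k" "j < k"
  show "card {t \<in> tuples k n. i \<noteq> j \<and> arc \<pi> (t i) \<inter> arc \<pi> (t j) \<noteq> {}} \<le> 3 * n ^ (k - 1)"
  proof (cases "i = j")
    case False
    \<comment> \<open>As \<open>i \<noteq> j\<close>, the entry \<open>t i\<close> survives the
      restriction, so the three forbidden values of \<open>t j\<close> are a function of the other
      slots.\<close>
    have "card {t \<in> tuples k n. i \<noteq> j \<and> arc \<pi> (t i) \<inter> arc \<pi> (t j) \<noteq> {}}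
       \<le> card {t \<in> tuples k n. t j \<in> (\<lambda>f. {f i, \<pi> (f i), inv \<pi> (f i)}) (restrict t ({..<k} - {j}))}"
      using arc_meet[OF assms] ij False by (intro card_mono) (auto intro!: finite_PiE)
    also have "\<dots> \<le> 3 * n ^ (k - 1)"
      by (rule card_tuples_hit[OF ij(2)]) (auto simp: card_three)
    finally show ?thesis .
  qed simp
qed (auto intro!: finite_PiE)

section \<open>Variance of the pattern density\<close>

definition pattern_average :: "nat \<Rightarrow> (nat \<Rightarrow> nat) \<Rightarrow> nat \<Rightarrow> (nat \<Rightarrow> nat) \<Rightarrow> (nat \<Rightarrow> real) \<Rightarrow> real" where
  "pattern_average k v n \<pi> \<omega> = (\<Sum>t\<in>tuples k n. pattern_at k v \<pi> t \<omega>) / real n ^ k"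

lemma finite_tuples: "finite (tuples k n)"
  by (intro finite_PiE) auto

lemma card_tuples: "card (tuples k n) = n ^ k"
  by (simp add: card_PiE)

lemma sum_of_bool_card: "finite S \<Longrightarrow> (\<Sum>x\<in>S. of_bool (P x)) = real (card {x \<in> S. P x})"
  by (simp add: Int_def)

text \<open>Expanding the square gives a sum over pairs of tuples in which all but a fraction of
  order 1/n of the terms vanish or are negative. For a tuple with meeting arcs the reference value
  may differ from the mean; this bias is absorbed into the same exceptional terms.\<close>

lemma second_moment_centred_average:
  assumes "inj \<pi>" "k \<ge> 1" "n \<ge> 1"
  shows "iid.expectation (\<lambda>\<omega>. ((\<Sum>t\<in>tuples k n. pattern_at k v \<pi> t \<omega> -
      pattern_prob_on_diag k v (fixed_slots k \<pi> t)) / real n ^ k)\<^sup>2) \<le> 6 * (real k)\<^sup>2 / real n"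
proof -
  define q where "q t = pattern_prob_on_diag k v (fixed_slots k \<pi> t)" for t
  define D where "D t \<omega> = pattern_at k v \<pi> t \<omega> - q t" for t \<omega>
  define bad where "bad t \<longleftrightarrow> (\<exists>i<k. \<exists>j<k. i \<noteq> j \<and> arc \<pi> (t i) \<inter> arc \<pi> (t j) \<noteq> {})" for t
  define cross where "cross t s \<longleftrightarrow> (\<exists>i<k. \<exists>j<k. arc \<pi> (t i) \<inter> arc \<pi> (s j) \<noteq> {})" for t s
  let ?T = "tuples k n"
  define B where "B = real (k * k * (3 * n ^ (k - 1)))"
  have [simp]: "finite ?T" by (rule finite_tuples)
  have D1: "\<bar>D t \<omega>\<bar> \<le> 1" for t \<omega>
    using pattern_at_bounds[of k v \<pi> t \<omega>] pattern_prob_on_diag_bounds[of k v "fixed_slots k \<pi> t"]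
    by (auto simp: D_def q_def abs_le_iff)
  have mD [measurable]: "D t \<in> borel_measurable iid_unif" for t
    unfolding D_def by measurable
  have DD1: "\<bar>D t \<omega> * D s \<omega>\<bar> \<le> 1" for t s \<omega>
    unfolding abs_mult using D1[of t \<omega>] D1[of s \<omega>] by (simp add: mult_le_one)
  have intDD: "integrable iid_unif (\<lambda>\<omega>. D t \<omega> * D s \<omega>)" for t s
    using DD1 by (intro iid.integrable_const_bound[where B = 1]) auto
  \<comment> \<open>It is enough that \<open>t\<close> is good and that no arc of \<open>t\<close>
    meets one of \<open>s\<close>: the expectation factorizes and the factor of \<open>t\<close> is
    zero, whatever the arcs of \<open>s\<close> do among themselves. All other pairs are bounded by
    1.\<close>
  have cov: "iid.expectation (\<lambda>\<omega>. D t \<omega> * D s \<omega>) \<le> of_bool (bad t) + of_bool (cross t s)" for t s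
  proof (cases "bad t \<or> cross t s")
    case True
    have "iid.expectation (\<lambda>\<omega>. D t \<omega> * D s \<omega>) \<le> iid.expectation (\<lambda>\<omega>. 1)"
      using DD1 by (intro integral_mono intDD) (auto simp: abs_le_iff)
    also have "\<dots> \<le> of_bool (bad t) + of_bool (cross t s)"
      using True iid.prob_space by auto
    finally show ?thesis .
  next
    case False
    have "iid.expectation (pattern_at k v \<pi> t) = q t"
      unfolding q_def by (rule expectation_pattern_at) (use False assms in \<open>auto simp: bad_def\<close>)
    moreover have "iid.expectation (\<lambda>\<omega>. D t \<omega> * D s \<omega>) =
       (iid.expectation (pattern_at k v \<pi> t) - q t) * (iid.expectation (pattern_at k v \<pi> s) - q s)"
      unfolding D_def by (rule pattern_at_indep) (use False in \<open>auto simp: cross_def\<close>)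
    ultimately show ?thesis by simp
  qed
  have bad: "(\<Sum>t\<in>?T. of_bool (bad t)) \<le> B"
    unfolding B_def bad_def sum_of_bool_card[OF \<open>finite ?T\<close>] of_nat_le_iff
    by (rule card_tuples_self_cross[OF assms(1)])
  have cross: "(\<Sum>s\<in>?T. of_bool (cross t s)) \<le> B" for t
    unfolding B_def cross_def sum_of_bool_card[OF \<open>finite ?T\<close>] of_nat_le_iff
    by (rule card_tuples_cross[OF assms(1)])
  have "iid.expectation (\<lambda>\<omega>. (\<Sum>t\<in>?T. D t \<omega>)\<^sup>2) = (\<Sum>t\<in>?T. \<Sum>s\<in>?T. iid.expectation (\<lambda>\<omega>. D t \<omega> * D s \<omega>))"
    by (simp add: power2_eq_square sum_product integral_sum intDD integrable_sum)
  also have "\<dots> \<le> (\<Sum>t\<in>?T. \<Sum>s\<in>?T. of_bool (bad t) + of_bool (cross t s))"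
    by (intro sum_mono cov)
  also have "\<dots> = real (n ^ k) * (\<Sum>t\<in>?T. of_bool (bad t)) + (\<Sum>t\<in>?T. \<Sum>s\<in>?T. of_bool (cross t s))"
    by (simp add: sum.distrib card_tuples sum_distrib_left)
  \<comment> \<open>Every bad \<open>t\<close> is paired with all \<open>n ^ k\<close> tuples
    \<open>s\<close>, and every \<open>t\<close> crosses at most \<open>B\<close> of them. The two
    contributions of \<open>3 * k^2\<close> make the 6.\<close>
  also have "\<dots> \<le> real (n ^ k) * B + (\<Sum>t\<in>?T. B)"
    by (intro add_mono mult_left_mono bad sum_mono cross) auto
  also have "\<dots> = real n ^ k * (6 * (real k)\<^sup>2 * real n ^ (k - 1))"
    by (simp add: card_tuples B_def power2_eq_square algebra_simps)
  finally have "iid.expectation (\<lambda>\<omega>. (\<Sum>t\<in>?T. D t \<omega>)\<^sup>2) / (real n ^ k)\<^sup>2 \<le>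
      real n ^ k * (6 * (real k)\<^sup>2 * real n ^ (k - 1)) / (real n ^ k)\<^sup>2"
    by (rule divide_right_mono) simp
  also have "\<dots> = 6 * (real k)\<^sup>2 * real n ^ (k - 1) / real n ^ k"
    using assms by (simp add: power2_eq_square)
  also have "\<dots> = 6 * (real k)\<^sup>2 / real n"
    using assms by (cases k) auto
  finally show ?thesis
    by (simp add: D_def q_def power_divide)
qed

text \<open>Prescribing \<open>fixed_slots\<close> leaves each slot free to range over the fixed
  points or over their complement, independently of the others. This product structure depends on
  allowing repetitions and is why the identity holds without an error term.\<close>

lemma average_pattern_prob_on_diag:
  assumes "n \<ge> 1"
  shows "(\<Sum>t\<in>tuples k n. pattern_prob_on_diag k v (fixed_slots k \<pi> t)) / real n ^ k =
    mixed_pattern_prob k v (real (fixed_points n \<pi>) / real n)"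
proof -
  define Fx where "Fx = {i \<in> {..<n}. \<pi> i = i}"
  define m where "m = fixed_points n \<pi>"
  have m: "card Fx = m" by (simp add: Fx_def m_def fixed_points_def)
  have "card ({..<n} - Fx) = n - m"
    using m by (subst card_Diff_subset) (auto simp: Fx_def)
  moreover have mn: "m \<le> n"
    using m card_mono[of "{..<n}" Fx] by (auto simp: Fx_def)
  ultimately have m': "real (card ({..<n} - Fx)) = real n - real m" by simp
  have card: "real (card {t \<in> tuples k n. fixed_slots k \<pi> t = A}) =
      real m ^ card A * (real n - real m) ^ card ({..<k} - A)" if A: "A \<subseteq> {..<k}" for A
  proof -
    have "{t \<in> tuples k n. fixed_slots k \<pi> t = A} =
        PiE {..<k} (\<lambda>j. if j \<in> A then Fx else {..<n} - Fx)"
      using A by (auto simp: fixed_slots_def Fx_def PiE_iff extensional_def split: if_splits)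
    also have "real (card \<dots>) = (\<Prod>j\<in>{..<k}. if j \<in> A then real m else real n - real m)"
      by (subst card_PiE) (auto simp: m m' intro!: prod.cong)
    also have "\<dots> = (\<Prod>j\<in>A. real m) * (\<Prod>j\<in>{..<k} - A. real n - real m)"
      using A by (subst prod.subset_diff[of A]) (auto simp: mult.commute)
    finally show ?thesis by simp
  qed
  have "(\<Sum>t\<in>tuples k n. pattern_prob_on_diag k v (fixed_slots k \<pi> t)) =
     (\<Sum>A\<in>Pow {..<k}. \<Sum>t\<in>{t \<in> tuples k n. fixed_slots k \<pi> t = A}. pattern_prob_on_diag k v (fixed_slots k \<pi> t))"
    by (rule sum.group[symmetric]) (auto simp: finite_tuples fixed_slots_def)
  also have "\<dots> = (\<Sum>A\<in>Pow {..<k}. real m ^ card A * (real n - real m) ^ card ({..<k} - A) * pattern_prob_on_diag k v A)"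
    by (intro sum.cong refl) (auto simp flip: card)
  finally have *: "(\<Sum>t\<in>tuples k n. pattern_prob_on_diag k v (fixed_slots k \<pi> t)) / real n ^ k =
     (\<Sum>A\<in>Pow {..<k}. real m ^ card A * (real n - real m) ^ card ({..<k} - A) * pattern_prob_on_diag k v A / real n ^ k)"
    by (simp add: sum_divide_distrib)
  show ?thesis
    unfolding * mixed_pattern_prob_def m_def[symmetric]
  proof (rule sum.cong[OF refl])
    fix A assume "A \<in> Pow {..<k}"
    then have "card A + card ({..<k} - A) = k"
      using card_mono[of "{..<k}" A] finite_subset[of A "{..<k}"] by (simp add: card_Diff_subset)
    then have "real n ^ k = real n ^ card A * real n ^ card ({..<k} - A)"
      by (simp flip: power_add)
    moreover have "1 - real m / real n = (real n - real m) / real n"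
      using assms by (simp add: field_simps)
    ultimately show "real m ^ card A * (real n - real m) ^ card ({..<k} - A) * pattern_prob_on_diag k v A / real n ^ k =
       (real m / real n) ^ card A * (1 - real m / real n) ^ card ({..<k} - A) * pattern_prob_on_diag k v A"
      by (simp add: power_divide)
  qed
qed

lemma pattern_average_bounds:
  "0 \<le> pattern_average k v n \<pi> \<omega>" "pattern_average k v n \<pi> \<omega> \<le> 1"
proof -
  show "0 \<le> pattern_average k v n \<pi> \<omega>"
    unfolding pattern_average_def by (intro divide_nonneg_nonneg sum_nonneg) (auto simp: pattern_at_bounds)
  have "(\<Sum>t\<in>tuples k n. pattern_at k v \<pi> t \<omega>) \<le> of_nat (card (tuples k n)) * 1"
    by (rule sum_bounded_above) (rule pattern_at_bounds)
  then show "pattern_average k v n \<pi> \<omega> \<le> 1"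
    unfolding pattern_average_def card_tuples by (auto simp: divide_le_eq_1 intro: order.order_iff_strict)
qed

lemma measurable_pattern_average [measurable]: "pattern_average k v n \<pi> \<in> borel_measurable iid_unif"
  unfolding pattern_average_def by measurable

text \<open>The deviation from \<open>p\<close> splits into the fluctuation around \<open>Q\<close>
  and the number \<open>Q - p\<close>. The inequality (x + y)^2 \<le> 2 x^2 + 2 y^2 avoids the mixed
  term and doubles the constant 6 to 12.\<close>

lemma expectation_pattern_average_deviation:
  assumes "inj \<pi>" "k \<ge> 1" "n \<ge> 1"
  shows "iid.expectation (\<lambda>\<omega>. (pattern_average k v n \<pi> \<omega> - p)\<^sup>2) \<le>
    12 * (real k)\<^sup>2 / real n + 2 * (mixed_pattern_prob k v (real (fixed_points n \<pi>) / real n) - p)\<^sup>2"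
proof -
  define Q where "Q = mixed_pattern_prob k v (real (fixed_points n \<pi>) / real n)"
  let ?X = "\<lambda>\<omega>. pattern_average k v n \<pi> \<omega> - Q"
  have Xeq: "?X \<omega> = (\<Sum>t\<in>tuples k n. pattern_at k v \<pi> t \<omega> -
      pattern_prob_on_diag k v (fixed_slots k \<pi> t)) / real n ^ k" for \<omega>
    unfolding Q_def pattern_average_def average_pattern_prob_on_diag[OF assms(3), symmetric] sum_subtractf
    by (rule diff_divide_distrib[symmetric])
  have int: "integrable iid_unif (\<lambda>\<omega>. (pattern_average k v n \<pi> \<omega> - c)\<^sup>2)" for c
  proof (rule iid.integrable_const_bound[where B = "(1 + \<bar>c\<bar>)\<^sup>2"])
    have "\<bar>pattern_average k v n \<pi> \<omega> - c\<bar> \<le> 1 + \<bar>c\<bar>" for \<omega>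
      using pattern_average_bounds[of k v n \<pi> \<omega>] by linarith
    then show "AE \<omega> in iid_unif. norm ((pattern_average k v n \<pi> \<omega> - c)\<^sup>2) \<le> (1 + \<bar>c\<bar>)\<^sup>2"
      by (auto simp: power2_le_iff_abs_le)
  qed measurable
  have "iid.expectation (\<lambda>\<omega>. (pattern_average k v n \<pi> \<omega> - p)\<^sup>2) \<le>
     iid.expectation (\<lambda>\<omega>. 2 * (?X \<omega>)\<^sup>2 + 2 * (Q - p)\<^sup>2)"
  proof (rule integral_mono)
    fix \<omega>
    show "(pattern_average k v n \<pi> \<omega> - p)\<^sup>2 \<le> 2 * (?X \<omega>)\<^sup>2 + 2 * (Q - p)\<^sup>2"
      using zero_le_power2[of "?X \<omega> - (Q - p)"] by (simp add: power2_eq_square algebra_simps)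
  qed (auto intro!: int)
  also have "\<dots> = 2 * iid.expectation (\<lambda>\<omega>. (?X \<omega>)\<^sup>2) + 2 * (Q - p)\<^sup>2"
    using int iid.prob_space by simp
  also have "iid.expectation (\<lambda>\<omega>. (?X \<omega>)\<^sup>2) \<le> 6 * (real k)\<^sup>2 / real n"
    unfolding Xeq by (rule second_moment_centred_average[OF assms])
  finally show ?thesis by (simp add: Q_def)
qed

section \<open>Ranks and pattern counts\<close>

lemma AE_unif_square_neq: "AE z in unif_square. fst z \<noteq> snd z"
proof -
  interpret a: prob_space unif01 by (rule prob_space_unif01)
  interpret pair_sigma_finite unif01 unif01 ..
  have "AE z in unif01 \<Otimes>\<^sub>M unif01. fst z \<noteq> snd z"
  proof (rule AE_pair_measure)
    show "AE x in unif01. AE y in unif01. fst (x, y) \<noteq> snd (x, y)"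
      using AE_unif01_neq by (auto simp: eq_commute)
    have "{z :: real \<times> real. fst z \<noteq> snd z} \<in> sets borel"
      by (intro borel_open open_Collect_neq continuous_intros)
    then show "{z \<in> space (unif01 \<Otimes>\<^sub>M unif01). fst z \<noteq> snd z} \<in> sets (unif01 \<Otimes>\<^sub>M unif01)"
      by (simp add: space_pair_measure borel_prod[symmetric] sets_pair_measure_cong[OF sets_unif01 sets_unif01])
  qed
  then show ?thesis unfolding unif_square_eq .
qed

text \<open>There are countably many pairs of indices, and \<open>unif_square\<close> gives the
  diagonal measure 0. Without ties the ranks of the labels form a permutation.\<close>

lemma AE_iid_unif_inj: "AE \<omega> in iid_unif. inj \<omega>"
proof -
  have "AE \<omega> in iid_unif. \<omega> a \<noteq> \<omega> b" if "a \<noteq> b" for a b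
  proof -
    have d: "distr iid_unif borel (\<lambda>\<omega>. (\<omega> a, \<omega> b)) = unif_square"
      using that by (simp add: distr_iid_unif_pair)
    have "(\<lambda>\<omega>. (\<omega> a, \<omega> b)) \<in> borel_measurable iid_unif"
      unfolding borel_prod[symmetric] by (intro measurable_Pair iid_unif_component)
    from AE_distrD[OF this, unfolded d, OF AE_unif_square_neq] show ?thesis by simp
  qed
  then have "AE \<omega> in iid_unif. \<forall>a b. a \<noteq> b \<longrightarrow> \<omega> a \<noteq> \<omega> b"
    by (auto simp: AE_all_countable)
  then show ?thesis by (auto simp: inj_def)
qed

lemma rank_permutation:
  fixes \<omega> :: "nat \<Rightarrow> 'a :: linorder"
  assumes "inj_on \<omega> {..<n}"
  obtains \<rho> where "\<rho> permutes {..<n}" "\<And>i j. i < n \<Longrightarrow> j < n \<Longrightarrow> \<omega> i < \<omega> j \<longleftrightarrow> \<rho> i < \<rho> j"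
proof -
  \<comment> \<open>The rank is the number of smaller labels, counted from 0; the value
    \<open>i\<close> beyond \<open>n\<close> is what \<open>permutes\<close> demands.\<close>
  define \<rho> where "\<rho> i = (if i < n then card {j \<in> {..<n}. \<omega> j < \<omega> i} else i)" for i
  have less: "\<rho> i < \<rho> j" if "i < n" "j < n" "\<omega> i < \<omega> j" for i j
    unfolding \<rho>_def using that by (auto intro!: psubset_card_mono)
  have iff: "\<omega> i < \<omega> j \<longleftrightarrow> \<rho> i < \<rho> j" if "i < n" "j < n" for i j
    using less[OF that] less[OF that(2,1)] inj_onD[OF assms, of i j] that
    by (cases "\<omega> i" "\<omega> j" rule: linorder_cases) auto
  have inj: "inj_on \<rho> {..<n}"
    by (rule inj_onI) (metis assms iff inj_onD lessThan_iff less_irrefl linorder_neqE)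
  have "\<rho> ` {..<n} \<subseteq> {..<n}"
  proof (rule image_subsetI)
    fix i assume "i \<in> {..<n}"
    then have "card {j \<in> {..<n}. \<omega> j < \<omega> i} < card {..<n}"
      by (intro psubset_card_mono) auto
    then show "\<rho> i \<in> {..<n}" using \<open>i \<in> {..<n}\<close> by (simp add: \<rho>_def)
  qed
  then have "bij_betw \<rho> {..<n} {..<n}"
    using inj by (simp add: bij_betw_def endo_inj_surj)
  then have "\<rho> permutes {..<n}"
    by (rule bij_imp_permutes) (simp add: \<rho>_def)
  then show ?thesis using iff that by blast
qed

lemma sample_pattern_order_cong:
  assumes "\<And>i j. i < k \<Longrightarrow> j < k \<Longrightarrow> fst (p i) < fst (p j) \<longleftrightarrow> fst (p' i) < fst (p' j)"
    and "\<And>i j. i < k \<Longrightarrow> j < k \<Longrightarrow> snd (p i) < snd (p j) \<longleftrightarrow> snd (p' i) < snd (p' j)"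
  shows "sample_pattern k p v = sample_pattern k p' v"
proof -
  have "\<sigma> a < k" if "\<sigma> permutes {..<k}" "a < k" for \<sigma> a
    using that permutes_in_image[of \<sigma> "{..<k}" a] by auto
  then show ?thesis
    unfolding sample_pattern_def using assms by (intro ex_cong1) (auto; metis)
qed

text \<open>Applying \<open>\<rho>\<close> to the entries of a tuple permutes the tuples. The
  conjugate sends \<open>\<rho> (t j)\<close> to \<open>\<rho> (\<pi> (t j))\<close>, so the point
  it draws there has ranks as coordinates where \<open>\<pi>\<close> had the labels, and patterns
  see only the order.\<close>

lemma pattern_average_conj:
  assumes \<rho>: "\<rho> permutes {..<n}" and \<pi>: "\<pi> permutes {..<n}"
    and ord: "\<And>i j. i < n \<Longrightarrow> j < n \<Longrightarrow> \<omega> i < \<omega> j \<longleftrightarrow> \<rho> i < \<rho> j"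
  shows "pattern_average k v n \<pi> \<omega> = pattern_average k v n (\<rho> \<circ> \<pi> \<circ> inv \<rho>) real"
proof -
  have in_n: "\<rho> i < n \<longleftrightarrow> i < n" "inv \<rho> i < n \<longleftrightarrow> i < n" "\<pi> i < n \<longleftrightarrow> i < n" for i
    using permutes_in_image[OF \<rho>, of i] permutes_in_image[OF permutes_inv[OF \<rho>], of i]
      permutes_in_image[OF \<pi>, of i] by auto
  have inv: "inv \<rho> (\<rho> i) = i" "\<rho> (inv \<rho> i) = i" for i
    using permutes_inverses[OF \<rho>] by auto
  have "(\<Sum>t\<in>tuples k n. pattern_at k v \<pi> t \<omega>) = (\<Sum>t\<in>tuples k n. pattern_at k v (\<rho> \<circ> \<pi> \<circ> inv \<rho>) t real)"
  proof (rule sum.reindex_bij_witness[where j = "\<lambda>t. \<lambda>i\<in>{..<k}. \<rho> (t i)" and i = "\<lambda>t. \<lambda>i\<in>{..<k}. inv \<rho> (t i)"])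
    fix t assume t: "t \<in> tuples k n"
    then have tn: "t i < n" if "i < k" for i using that by auto
    show "pattern_at k v (\<rho> \<circ> \<pi> \<circ> inv \<rho>) (\<lambda>i\<in>{..<k}. \<rho> (t i)) real = pattern_at k v \<pi> t \<omega>"
      unfolding pattern_at_def of_bool_eq_iff
      by (rule sample_pattern_order_cong) (auto simp: inv tn in_n ord)
  qed (auto simp: PiE_iff inv in_n extensional_def fun_eq_iff)
  then show ?thesis by (simp add: pattern_average_def)
qed

lemma nth_sorted_list_of_image:
  assumes "\<And>a b. a < k \<Longrightarrow> b < k \<Longrightarrow> a < b \<Longrightarrow> f a < (f b :: nat)"
  shows "sorted_list_of_set (f ` {..<k}) = map f [0..<k]"
proof -
  have s: "sorted_wrt (<) (map f [0..<k])"
    unfolding sorted_wrt_map by (rule sorted_wrt_mono_rel[OF _ sorted_wrt_upt]) (use assms in auto)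
  have "sorted_list_of_set (set (map f [0..<k])) = map f [0..<k]"
    using s by (intro sorted_list_of_set.idem_if_sorted_distinct) (auto simp: strict_sorted_iff)
  then show ?thesis by (simp add: atLeast0LessThan)
qed

text \<open>A tuple showing the pattern is the same as a set \<open>S\<close> showing it together
  with one of the \<open>k!\<close> ways \<open>\<tau>\<close> to list \<open>S\<close>. Strictness
  in \<open>sample_pattern\<close> rules out tuples with repeated entries.\<close>

lemma card_pattern_tuples:
  "card {t \<in> tuples k n. sample_pattern k (\<lambda>j. (real (t j), real (\<pi> (t j)))) v} =
    fact k * pattern_count k v n \<pi>"
proof -
  define G where "G = {S. S \<subseteq> {..<n} \<and> card S = k \<and>
        (\<forall>a<k. \<forall>b<k. \<pi> (sorted_list_of_set S ! a) < \<pi> (sorted_list_of_set S ! b) \<longleftrightarrow> v a < v b)}"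
  define R where "R = {\<tau>. \<tau> permutes {..<k}}"
  define \<Phi> where "\<Phi> = (\<lambda>(S, \<tau>). \<lambda>j\<in>{..<k}. sorted_list_of_set S ! \<tau> j :: nat)"
  have len: "length (sorted_list_of_set S) = k" and set: "set (sorted_list_of_set S) = S"
    if "S \<in> G" for S
    using that finite_subset[of S "{..<n}"] by (auto simp: G_def)
  have in_k: "\<tau> j < k \<longleftrightarrow> j < k" if "\<tau> \<in> R" for \<tau> j
    using permutes_in_image[of \<tau> "{..<k}" j] that by (auto simp: R_def)
  have img: "\<Phi> (S, \<tau>) ` {..<k} = S" if "S \<in> G" "\<tau> \<in> R" for S \<tau>
  proof -
    have "\<Phi> (S, \<tau>) ` {..<k} = (!) (sorted_list_of_set S) ` \<tau> ` {..<k}"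
      by (auto simp: \<Phi>_def image_image)
    also have "\<tau> ` {..<k} = {..<k}" using that by (simp add: R_def permutes_image)
    also have "(!) (sorted_list_of_set S) ` {..<k} = set (sorted_list_of_set S)"
      using len[OF that(1)] by (auto simp: set_conv_nth)
    finally show ?thesis using set[OF that(1)] by simp
  qed
  \<comment> \<open>The entries of the tuple give back \<open>S\<close>; since the sorted list has
    no repetition, they then give back \<open>\<tau>\<close> on \<open>{..<k}\<close>, and elsewhere
    both permutations are the identity.\<close>
  have inj: "inj_on \<Phi> (G \<times> R)"
  proof (rule inj_onI, clarify)
    fix S \<tau> S' \<tau>' assume *: "S \<in> G" "\<tau> \<in> R" "S' \<in> G" "\<tau>' \<in> R" "\<Phi> (S, \<tau>) = \<Phi> (S', \<tau>')"
    then have S: "S = S'" using img by metis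
    have "\<tau> j = \<tau>' j" for j
    proof (cases "j < k")
      case True
      then have "sorted_list_of_set S ! \<tau> j = sorted_list_of_set S ! \<tau>' j"
        using fun_cong[OF *(5), of j] by (simp add: \<Phi>_def S)
      then show ?thesis
        using True * len[of S] in_k by (simp add: nth_eq_iff_index_eq)
    next
      case False
      then show ?thesis using * by (simp add: R_def permutes_not_in)
    qed
    then show "S = S' \<and> \<tau> = \<tau>'" using S by auto
  qed
  have "\<Phi> ` (G \<times> R) = {t \<in> tuples k n. sample_pattern k (\<lambda>j. (real (t j), real (\<pi> (t j)))) v}"
  proof (intro equalityI subsetI)
    fix t assume "t \<in> \<Phi> ` (G \<times> R)"
    then obtain S \<tau> where S: "S \<in> G" "\<tau> \<in> R" and t: "t = \<Phi> (S, \<tau>)" by auto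
    have "t \<in> tuples k n"
    proof (rule PiE_I)
      fix j assume "j \<in> {..<k}"
      then have "t j \<in> S" using img[OF S] t by blast
      then show "t j \<in> {..<n}" using S by (auto simp: G_def)
    qed (simp add: t \<Phi>_def)
    \<comment> \<open>Undoing the listing \<open>\<tau>\<close> sorts the tuple, so
      \<open>inv \<tau>\<close> is the witness for the existential in
      \<open>sample_pattern\<close>.\<close>
    moreover have "t (inv \<tau> a) = sorted_list_of_set S ! a" if "a < k" for a
    proof -
      have "inv \<tau> a < k" using S that permutes_in_image[OF permutes_inv, of \<tau> "{..<k}" a] by (auto simp: R_def)
      then show ?thesis using S permutes_inverses(1)[of \<tau> "{..<k}" a] by (simp add: t \<Phi>_def R_def)
    qed
    moreover have "sorted_list_of_set S ! a < sorted_list_of_set S ! b" if "a < b" "b < k" for a b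
      using that len[OF S(1)] strict_sorted_list_of_set[of S] by (auto simp: sorted_wrt_iff_nth_less)
    ultimately show "t \<in> {t \<in> tuples k n. sample_pattern k (\<lambda>j. (real (t j), real (\<pi> (t j)))) v}"
      using S unfolding sample_pattern_def
      by (auto simp: R_def G_def intro!: exI[of _ "inv \<tau>"] permutes_inv)
  next
    fix t assume t: "t \<in> {t \<in> tuples k n. sample_pattern k (\<lambda>j. (real (t j), real (\<pi> (t j)))) v}"
    then obtain \<sigma> where \<sigma>: "\<sigma> permutes {..<k}"
      and 1: "\<And>a b. a < k \<Longrightarrow> b < k \<Longrightarrow> a < b \<Longrightarrow> t (\<sigma> a) < t (\<sigma> b)"
      and 2: "\<And>a b. a < k \<Longrightarrow> b < k \<Longrightarrow> \<pi> (t (\<sigma> a)) < \<pi> (t (\<sigma> b)) \<longleftrightarrow> v a < v b"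
      unfolding sample_pattern_def by auto
    define S where "S = t ` {..<k}"
    have S': "S = (\<lambda>a. t (\<sigma> a)) ` {..<k}"
      unfolding S_def using permutes_image[OF \<sigma>] by (metis image_image)
    \<comment> \<open>By strict monotonicity the entries read along \<open>\<sigma>\<close> are the
      increasing enumeration of their set. This also yields \<open>card S = k\<close> and identifies
      the listing as \<open>inv \<sigma>\<close>.\<close>
    have sl: "sorted_list_of_set S = map (\<lambda>a. t (\<sigma> a)) [0..<k]"
      unfolding S' by (rule nth_sorted_list_of_image) (rule 1)
    have "card S = length (sorted_list_of_set S)" by simp
    then have "card S = k" by (simp add: sl)
    moreover have "S \<subseteq> {..<n}" using t by (auto simp: S_def)
    ultimately have "S \<in> G" using 2 by (simp add: G_def sl)
    moreover have "inv \<sigma> \<in> R" using \<sigma> by (simp add: R_def permutes_inv)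
    moreover have "t = \<Phi> (S, inv \<sigma>)"
    proof
      fix j
      have "inv \<sigma> j < k" if "j < k"
        using permutes_in_image[OF permutes_inv[OF \<sigma>], of j] that by simp
      then show "t j = \<Phi> (S, inv \<sigma>) j"
        using t by (auto simp: \<Phi>_def sl permutes_inverses[OF \<sigma>] PiE_iff extensional_def)
    qed
    ultimately show "t \<in> \<Phi> ` (G \<times> R)" by auto
  qed
  then have "card {t \<in> tuples k n. sample_pattern k (\<lambda>j. (real (t j), real (\<pi> (t j)))) v} = card (G \<times> R)"
    using card_image[OF inj] by simp
  also have "\<dots> = fact k * pattern_count k v n \<pi>"
    by (simp add: R_def G_def pattern_count_def card_cartesian_product card_permutations mult.commute)
  finally show ?thesis .
qed

lemma pattern_average_eq_count:
  "pattern_average k v n \<pi> real = fact k * real (pattern_count k v n \<pi>) / real n ^ k"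
  unfolding pattern_average_def pattern_at_def sum_of_bool_card[OF finite_tuples] card_pattern_tuples
  by simp

section \<open>Convergence in probability\<close>

text \<open>On [0,1] the polynomial is itself the probability of a pattern under
  \<open>mu_alpha\<close>. This applies to the limit and to every proportion of fixed points, which
  makes the later domination possible.\<close>

lemma mixed_pattern_prob_bounds:
  assumes "\<alpha> \<in> {0..1}"
  shows "0 \<le> mixed_pattern_prob k v \<alpha>" "mixed_pattern_prob k v \<alpha> \<le> 1"
proof -
  interpret product_prob_space "\<lambda>_. mu_alpha \<alpha>" "{..<k}"
    by (rule product_prob_spaceI) (rule prob_space_mu_alpha[OF assms])
  show "0 \<le> mixed_pattern_prob k v \<alpha>" "mixed_pattern_prob k v \<alpha> \<le> 1"
    unfolding permuton_pattern_prob_mu_alpha[OF assms, symmetric]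
    by (auto simp: permuton_pattern_prob_def)
qed

lemma isCont_mixed_pattern_prob: "isCont (mixed_pattern_prob k v) \<alpha>"
  unfolding mixed_pattern_prob_def by (intro continuous_intros)

lemma fixed_points_ratio: "real (fixed_points n \<pi>) / real n \<in> {0..1}"
proof -
  have "fixed_points n \<pi> \<le> card {..<n}"
    unfolding fixed_points_def by (rule card_mono) auto
  then show ?thesis by (auto simp: divide_le_eq_1)
qed

lemma pattern_count_le: "pattern_count k v n \<pi> \<le> n choose k"
proof -
  have "pattern_count k v n \<pi> \<le> card {S. S \<subseteq> {..<n} \<and> card S = k}"
    unfolding pattern_count_def by (rule card_mono) auto
  then show ?thesis by (simp add: n_subsets)
qed

text \<open>The ratio is the fraction of injective tuples: a product of \<open>k\<close> factors (n
  - i) / n, each tending to 1.\<close>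

lemma falling_factorial_ratio_tendsto:
  "(\<lambda>n. fact k * real (n choose k) / real n ^ k) \<longlonglongrightarrow> 1"
proof -
  have "(\<lambda>n. (real n - real i) / real n) \<longlonglongrightarrow> 1" for i
    by real_asymp
  then have "(\<lambda>n. \<Prod>i=0..<k. (real n - real i) / real n) \<longlonglongrightarrow> (\<Prod>i=0..<k. 1)"
    by (intro tendsto_prod)
  moreover have "(\<Prod>i=0..<k. (real n - real i) / real n) = fact k * real (n choose k) / real n ^ k" for n
    by (simp add: prod_dividef binomial_gbinomial gbinomial_prod_rev)
  ultimately show ?thesis by simp
qed

text \<open>The average is the density times the fraction of injective tuples, and the density lies
  in [0,1]; the bound is thus deterministic and uniform in \<open>\<pi>\<close>.\<close>

lemma pattern_density_minus_average:
  "\<bar>real (pattern_count k v n \<pi>) / real (n choose k) - pattern_average k v n \<pi> real\<bar>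
    \<le> \<bar>1 - fact k * real (n choose k) / real n ^ k\<bar>"
proof (cases "n choose k = 0")
  \<comment> \<open>Here \<open>n < k\<close>: there are no patterns to count, and both terms of the
    difference are 0.\<close>
  case True
  then have "pattern_count k v n \<pi> = 0"
    using pattern_count_le[of k v n \<pi>] by linarith
  then show ?thesis by (simp add: pattern_average_eq_count)
next
  case False
  define d where "d = real (pattern_count k v n \<pi>) / real (n choose k)"
  have "0 \<le> d" "d \<le> 1"
    using pattern_count_le[of k v n \<pi>] False by (auto simp: d_def divide_le_eq_1)
  moreover have "d - pattern_average k v n \<pi> real = d * (1 - fact k * real (n choose k) / real n ^ k)"
    using False by (simp add: d_def pattern_average_eq_count field_simps)
  ultimately show ?thesis
    unfolding d_def[symmetric] by (simp add: abs_mult mult_left_le_one_le)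
qed

text \<open>Integrals over \<open>M\<close> become finite sums over permutations, so exchanging them
  with the integral over the labels is mere linearity.\<close>

lemma (in prob_space) expectation_finite_range:
  fixes h :: "'b \<Rightarrow> real"
  assumes "X \<in> measurable M (count_space UNIV)" "finite S" "\<And>x. x \<in> space M \<Longrightarrow> X x \<in> S"
  shows "expectation (\<lambda>x. h (X x)) = (\<Sum>s\<in>S. prob {x \<in> space M. X x = s} * h s)"
proof -
  have m: "{x \<in> space M. X x = s} \<in> events" for s
    using measurable_sets[OF assms(1), of "{s}"] by (simp add: vimage_def Int_def conj_commute)
  have "expectation (\<lambda>x. h (X x)) = expectation (\<lambda>x. \<Sum>s\<in>S. indicator {x \<in> space M. X x = s} x * h s)"
  proof (rule Bochner_Integration.integral_cong[OF refl])
    fix x assume x: "x \<in> space M"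
    have "(\<Sum>s\<in>S. indicator {x \<in> space M. X x = s} x * h s) = (\<Sum>s\<in>S. if s = X x then h s else 0)"
      using x by (intro sum.cong) (auto simp: indicator_def)
    then show "h (X x) = (\<Sum>s\<in>S. indicator {x \<in> space M. X x = s} x * h s)"
      using assms(2,3) x by simp
  qed
  also have "\<dots> = (\<Sum>s\<in>S. prob {x \<in> space M. X x = s} * h s)"
    using m by (subst Bochner_Integration.integral_sum) (auto simp: integrable_real_indicator emeasure_eq_measure)
  finally show ?thesis .
qed

text \<open>Sampling i.i.d. uniform labels \<open>\<omega>\<close> and relabelling by their ranks conjugates the
  permutation; this does not change its law, so the discrete pattern average may be replaced by
  the one read off from the points \<open>(\<omega> i, \<omega> (\<pi> i))\<close>.\<close>

lemma expectation_average_deviation_conj_inv: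
  fixes X :: "'a \<Rightarrow> nat \<Rightarrow> nat"
  assumes "prob_space M"
    and meas: "X \<in> measurable M (count_space UNIV)"
    and perm: "\<And>x. x \<in> space M \<Longrightarrow> X x permutes {..<n}"
    and conj_inv: "\<And>w \<pi>. w permutes {..<n} \<Longrightarrow> \<pi> permutes {..<n} \<Longrightarrow>
        measure M {x \<in> space M. X x = inv w \<circ> \<pi> \<circ> w} = measure M {x \<in> space M. X x = \<pi>}"
    and "k \<ge> 1" "n \<ge> 1"
  shows "(\<integral>x. (pattern_average k v n (X x) real - p)\<^sup>2 \<partial>M) \<le>
    (\<integral>x. 12 * (real k)\<^sup>2 / real n + 2 * (mixed_pattern_prob k v (real (fixed_points n (X x)) / real n) - p)\<^sup>2 \<partial>M)"
proof -
  interpret M: prob_space M by fact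
  define S where "S = {\<pi>. \<pi> permutes {..<n}}"
  define P where "P \<pi> = M.prob {x \<in> space M. X x = \<pi>}" for \<pi>
  define a where "a \<pi> \<omega> = (pattern_average k v n \<pi> \<omega> - p)\<^sup>2" for \<pi> \<omega>
  have fin: "finite S" by (simp add: S_def finite_permutations)
  have expand: "(\<integral>x. h (X x) \<partial>M) = (\<Sum>\<pi>\<in>S. P \<pi> * h \<pi>)" for h :: "_ \<Rightarrow> real"
    unfolding P_def by (rule M.expectation_finite_range[OF meas fin]) (simp add: S_def perm)
  \<comment> \<open>Nothing is averaged over the labels yet. For one fixed labelling, conjugation by
    its ranks reindexes the sum, keeps the weights by conjugacy invariance, and trades the labels
    for \<open>real\<close>.\<close>
  have relabel: "(\<Sum>\<pi>\<in>S. P \<pi> * a \<pi> real) = (\<Sum>\<pi>\<in>S. P \<pi> * a \<pi> \<omega>)" if "inj \<omega>" for \<omega>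
  proof -
    obtain \<rho> where \<rho>: "\<rho> permutes {..<n}" and ord: "\<And>i j. i < n \<Longrightarrow> j < n \<Longrightarrow> \<omega> i < \<omega> j \<longleftrightarrow> \<rho> i < \<rho> j"
      using rank_permutation[of \<omega> n] \<open>inj \<omega>\<close> by (metis inj_on_subset subset_UNIV)
    show ?thesis
    proof (rule sum.reindex_bij_witness[where j = "\<lambda>\<pi>. inv \<rho> \<circ> \<pi> \<circ> \<rho>" and i = "\<lambda>\<pi>. \<rho> \<circ> \<pi> \<circ> inv \<rho>"])
      fix \<pi> assume "\<pi> \<in> S"
      then have \<pi>: "\<pi> permutes {..<n}" by (simp add: S_def)
      show "\<rho> \<circ> (inv \<rho> \<circ> \<pi> \<circ> \<rho>) \<circ> inv \<rho> = \<pi>" "inv \<rho> \<circ> (\<rho> \<circ> \<pi> \<circ> inv \<rho>) \<circ> \<rho> = \<pi>"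
        using permutes_inverses[OF \<rho>] by (simp_all add: fun_eq_iff)
      show c: "inv \<rho> \<circ> \<pi> \<circ> \<rho> \<in> S" "\<rho> \<circ> \<pi> \<circ> inv \<rho> \<in> S"
        using \<pi> \<rho> by (auto simp: S_def intro!: permutes_compose permutes_inv)
      have "P (inv \<rho> \<circ> \<pi> \<circ> \<rho>) = P \<pi>"
        unfolding P_def by (rule conj_inv[OF \<rho> \<pi>])
      moreover have "pattern_average k v n (inv \<rho> \<circ> \<pi> \<circ> \<rho>) \<omega> = pattern_average k v n \<pi> real"
        using pattern_average_conj[OF \<rho> _ ord, of "inv \<rho> \<circ> \<pi> \<circ> \<rho>" k v] c(1) permutes_inverses[OF \<rho>]
        by (simp add: S_def o_def)
      ultimately show "P (inv \<rho> \<circ> \<pi> \<circ> \<rho>) * a (inv \<rho> \<circ> \<pi> \<circ> \<rho>) \<omega> = P \<pi> * a \<pi> real"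
        by (simp add: a_def)
    qed
  qed
  have int: "integrable iid_unif (a \<pi>)" for \<pi>
  proof (rule iid.integrable_const_bound[where B = "(1 + \<bar>p\<bar>)\<^sup>2"])
    have "\<bar>pattern_average k v n \<pi> \<omega> - p\<bar> \<le> 1 + \<bar>p\<bar>" for \<omega>
      using pattern_average_bounds[of k v n \<pi> \<omega>] by linarith
    then show "AE \<omega> in iid_unif. norm (a \<pi> \<omega>) \<le> (1 + \<bar>p\<bar>)\<^sup>2"
      by (auto simp: a_def power2_le_iff_abs_le)
  qed (unfold a_def, measurable)
  have "(\<integral>x. (pattern_average k v n (X x) real - p)\<^sup>2 \<partial>M) = (\<Sum>\<pi>\<in>S. P \<pi> * a \<pi> real)"
    using expand[of "\<lambda>\<pi>. a \<pi> real"] by (simp add: a_def)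
  \<comment> \<open>The sum is constant in \<open>\<omega>\<close>, so it equals its expectation;
    inside the expectation \<open>relabel\<close> applies to almost every
    \<open>\<omega>\<close>.\<close>
  also have "\<dots> = iid.expectation (\<lambda>\<omega>. \<Sum>\<pi>\<in>S. P \<pi> * a \<pi> real)"
    using iid.prob_space by simp
  also have "\<dots> = iid.expectation (\<lambda>\<omega>. \<Sum>\<pi>\<in>S. P \<pi> * a \<pi> \<omega>)"
  proof (rule integral_cong_AE)
    show "AE \<omega> in iid_unif. (\<Sum>\<pi>\<in>S. P \<pi> * a \<pi> real) = (\<Sum>\<pi>\<in>S. P \<pi> * a \<pi> \<omega>)"
      using AE_iid_unif_inj by eventually_elim (rule relabel)
  qed (use int in \<open>auto intro!: borel_measurable_sum\<close>)
  also have "\<dots> = (\<Sum>\<pi>\<in>S. P \<pi> * iid.expectation (a \<pi>))"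
    using int by (subst Bochner_Integration.integral_sum) auto
  also have "\<dots> \<le> (\<Sum>\<pi>\<in>S. P \<pi> * (12 * (real k)\<^sup>2 / real n +
      2 * (mixed_pattern_prob k v (real (fixed_points n \<pi>) / real n) - p)\<^sup>2))"
    unfolding a_def using assms(5,6)
    by (intro sum_mono mult_left_mono expectation_pattern_average_deviation)
       (auto simp: S_def P_def permutes_inj)
  finally show ?thesis by (simp add: expand[symmetric])
qed

theorem theorem5p10:
  fixes M :: "'a measure" and \<Sigma> :: "nat \<Rightarrow> 'a \<Rightarrow> (nat \<Rightarrow> nat)" and \<alpha> :: real
  assumes "prob_space M"
    and meas: "\<And>n. \<Sigma> n \<in> measurable M (count_space UNIV)"
    and perm: "\<And>n x. x \<in> space M \<Longrightarrow> \<Sigma> n x permutes {..<n}"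
    and conj_inv: "\<And>n w \<pi>. w permutes {..<n} \<Longrightarrow> \<pi> permutes {..<n} \<Longrightarrow>
        measure M {x \<in> space M. \<Sigma> n x = inv w \<circ> \<pi> \<circ> w} = measure M {x \<in> space M. \<Sigma> n x = \<pi>}"
    and alpha: "\<alpha> \<in> {0..1}"
    and fp_lim: "AE x in M. (\<lambda>n. real (fixed_points n (\<Sigma> n x)) / real n) \<longlonglongrightarrow> \<alpha>"
    and k: "k \<ge> 1" and v: "v permutes {..<k}"
  shows "\<forall>\<epsilon>>0. (\<lambda>n. measure M {x \<in> space M.
            \<bar>real (pattern_count k v n (\<Sigma> n x)) / real (n choose k)
              - permuton_pattern_prob (mu_alpha \<alpha>) k v\<bar> > \<epsilon>}) \<longlonglongrightarrow> 0"
proof (intro allI impI)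
  fix \<epsilon> :: real assume \<epsilon>: "\<epsilon> > 0"
  interpret M: prob_space M by fact
  define p where "p = mixed_pattern_prob k v \<alpha>"
  define Q where "Q n x = mixed_pattern_prob k v (real (fixed_points n (\<Sigma> n x)) / real n)" for n x
  define Avg where "Avg n x = pattern_average k v n (\<Sigma> n x) real" for n x
  define B where "B n x = 12 * (real k)\<^sup>2 / real n + 2 * (Q n x - p)\<^sup>2" for n x
  have p: "permuton_pattern_prob (mu_alpha \<alpha>) k v = p"
    unfolding p_def by (rule permuton_pattern_prob_mu_alpha[OF alpha])
  \<comment> \<open>The permutations carry the discrete sigma-algebra, so every real function of
    \<open>\<Sigma> n\<close> is a random variable.\<close>
  have meas': "(\<lambda>x. h (\<Sigma> n x)) \<in> borel_measurable M" for n and h :: "(nat \<Rightarrow> nat) \<Rightarrow> real"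
    by (rule measurable_compose[OF meas]) simp
  have [measurable]: "Q n \<in> borel_measurable M" "Avg n \<in> borel_measurable M" for n
    unfolding Q_def Avg_def by (rule meas')+
  have Qp: "\<bar>Q n x - p\<bar> \<le> 1" for n x
    using mixed_pattern_prob_bounds[OF alpha, of k v]
      mixed_pattern_prob_bounds[OF fixed_points_ratio, of k v n "\<Sigma> n x"]
    unfolding Q_def p_def by linarith
  have "(\<lambda>n. \<integral>x. B n x \<partial>M) \<longlonglongrightarrow> (\<integral>x. 0 \<partial>M)"
  \<comment> \<open>\<open>Q n x\<close> and \<open>p\<close> are probabilities, so the squared
    difference is at most 1; the first term of \<open>B\<close> is at most \<open>12 * k^2\<close>,
    also for \<open>n = 0\<close>, where the quotient is 0.\<close>
  proof (rule integral_dominated_convergence[where w = "\<lambda>_. 12 * (real k)\<^sup>2 + 2"])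
    show "AE x in M. (\<lambda>n. B n x) \<longlonglongrightarrow> 0"
      using fp_lim
    proof eventually_elim
      case (elim x)
      have "(\<lambda>n. Q n x) \<longlonglongrightarrow> p"
        unfolding Q_def p_def by (rule isCont_tendsto_compose[OF isCont_mixed_pattern_prob elim])
      moreover have "(\<lambda>n. 12 * (real k)\<^sup>2 / real n) \<longlonglongrightarrow> 0"
        by real_asymp
      ultimately have "(\<lambda>n. B n x) \<longlonglongrightarrow> 0 + 2 * (p - p)\<^sup>2"
        unfolding B_def by (intro tendsto_intros)
      then show ?case by simp
    qed
    fix n
    have "B n x \<le> 12 * (real k)\<^sup>2 + 2" for x
    proof -
      have "12 * (real k)\<^sup>2 / real n \<le> 12 * (real k)\<^sup>2"
        by (cases "n = 0") (auto simp: divide_le_eq mult_le_cancel_left1)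
      moreover have "(Q n x - p)\<^sup>2 \<le> 1"
        using Qp[of n x] by (simp add: abs_square_le_1)
      ultimately show ?thesis unfolding B_def by linarith
    qed
    then show "AE x in M. norm (B n x) \<le> 12 * (real k)\<^sup>2 + 2"
      by (auto simp: B_def)
  qed (auto simp: B_def)
  then have lim: "(\<lambda>n. (\<integral>x. B n x \<partial>M) / (\<epsilon> / 2)\<^sup>2) \<longlonglongrightarrow> 0"
    using tendsto_divide[OF _ tendsto_const, of _ 0 _ "(\<epsilon> / 2)\<^sup>2"] \<epsilon> by fastforce
  \<comment> \<open>Half of \<open>\<epsilon>\<close> pays for the deterministic change of
    normalisation from \<open>n^k / k!\<close> to \<open>n choose k\<close>; the other half is left
    for the random deviation of the average.\<close>
  have "eventually (\<lambda>n. \<bar>1 - fact k * real (n choose k) / real n ^ k\<bar> < \<epsilon> / 2) sequentially"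
    using tendstoD[OF falling_factorial_ratio_tendsto[of k], of "\<epsilon> / 2"] \<epsilon>
    by (simp add: dist_real_def abs_minus_commute)
  then have ev: "eventually (\<lambda>n. M.prob {x \<in> space M.
      \<bar>real (pattern_count k v n (\<Sigma> n x)) / real (n choose k) - p\<bar> > \<epsilon>} \<le>
      (\<integral>x. B n x \<partial>M) / (\<epsilon> / 2)\<^sup>2) sequentially"
    using eventually_ge_at_top[of 1]
  proof eventually_elim
    case (elim n)
    have int: "integrable M (\<lambda>x. (Avg n x - p)\<^sup>2)"
    proof (rule M.integrable_const_bound[where B = "(1 + \<bar>p\<bar>)\<^sup>2"])
      have "\<bar>Avg n x - p\<bar> \<le> 1 + \<bar>p\<bar>" for x
        using pattern_average_bounds[of k v n "\<Sigma> n x" real] unfolding Avg_def by linarith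
      then show "AE x in M. norm ((Avg n x - p)\<^sup>2) \<le> (1 + \<bar>p\<bar>)\<^sup>2"
        by (auto simp: power2_le_iff_abs_le)
    qed measurable
    have "M.prob {x \<in> space M. \<bar>real (pattern_count k v n (\<Sigma> n x)) / real (n choose k) - p\<bar> > \<epsilon>}
       \<le> M.prob {x \<in> space M. (\<epsilon> / 2)\<^sup>2 \<le> (Avg n x - p)\<^sup>2}"
    proof (rule M.finite_measure_mono)
      show "{x \<in> space M. \<bar>real (pattern_count k v n (\<Sigma> n x)) / real (n choose k) - p\<bar> > \<epsilon>} \<subseteq>
         {x \<in> space M. (\<epsilon> / 2)\<^sup>2 \<le> (Avg n x - p)\<^sup>2}"
      proof clarify
        fix x assume "\<bar>real (pattern_count k v n (\<Sigma> n x)) / real (n choose k) - p\<bar> > \<epsilon>"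
        then have "\<epsilon> / 2 \<le> \<bar>Avg n x - p\<bar>"
          using pattern_density_minus_average[of k v n "\<Sigma> n x"] elim(1) unfolding Avg_def by linarith
        then show "(\<epsilon> / 2)\<^sup>2 \<le> (Avg n x - p)\<^sup>2"
          using \<epsilon> by (simp add: abs_le_square_iff[symmetric])
      qed
    qed measurable
    \<comment> \<open>Chebyshev's inequality, as Markov's inequality for the square.\<close>
    also have "\<dots> \<le> (\<integral>x. (Avg n x - p)\<^sup>2 \<partial>M) / (\<epsilon> / 2)\<^sup>2"
      using \<epsilon> by (intro integral_Markov_inequality_measure[OF int, where A = "{}"]) auto
    also have "\<dots> \<le> (\<integral>x. B n x \<partial>M) / (\<epsilon> / 2)\<^sup>2"
      unfolding Avg_def B_def Q_def
      by (intro divide_right_mono expectation_average_deviation_conj_inv[OF assms(1) meas perm conj_inv k])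
         (use elim in auto)
    finally show ?case .
  qed
  show "(\<lambda>n. measure M {x \<in> space M.
            \<bar>real (pattern_count k v n (\<Sigma> n x)) / real (n choose k)
              - permuton_pattern_prob (mu_alpha \<alpha>) k v\<bar> > \<epsilon>}) \<longlonglongrightarrow> 0"
    unfolding p by (rule tendsto_sandwich[OF _ ev tendsto_const lim]) simp
qed

end
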